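(* In the fixed-proportion model with $n_1=n_1(n)$ non-nulls, $n_1/n\to\pi_1$ as $n\to\infty$, fix a level $\alpha\in[0,1]$. (i) For any $\beta\ge b^*(\alpha)$, the procedure $\delta^n_{\rm NP}(\alpha)$ satisfies, for any $\epsilon>0$, as $n\to\infty$, $$\mathbb P\big(\mathrm{FDP}(\delta^n_{\rm NP}(\alpha))\le\alpha+\epsilon\big)=1-o(1)\quad\text{and}\quad \mathbb P\big(\mathrm{FNP}(\delta^n_{\rm NP}(\alpha))\le\beta+\epsilon\big)=1-o(1).$$ (ii) Conversely, if a sequence of decision rules $\delta^n$ satisfies $\mathbb P(\mathrm{FDP}(\delta^n)\le\alpha)=1-o(1)$ as $n\to\infty$ and $\mathrm{FNR}(\delta^n)\le\beta$, then $\beta\ge b^*(\alpha)$.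
   Context: Let $\pi_0,\pi_1\in(0,1)$ with $\pi_0+\pi_1=1$, and let $f_0,f_1$ be probability densities on a sample space $\mathcal X$ (with respect to a common dominating measure), $f=\pi_0f_0+\pi_1f_1$. Fixed-proportion model: $\theta^n=(\theta_1,\dots,\theta_n)$ is uniformly distributed on $\{\theta^n\in\{0,1\}^n:\sum_i\theta_i=n_1\}$, where $n_1=n_1(n)$ is deterministic with $n_1/n\to\pi_1$; given $\theta^n$, the observations $X_1,\dots,X_n$ are independent with $X_i\sim f_{\theta_i}$. A (possibly randomized) decision rule $\delta^n=(\delta_1,\dots,\delta_n)$ is given by a Markov kernel from $\mathcal X^n$ to $\{0,1\}^n$ applied to $X^n$ (so $\delta^n$ is conditionally independent of $\theta^n$ given $X^n$). $\mathrm{FDP}(\delta^n)=\frac{\sum_i\delta_i(1-\theta_i)}{1\vee\sum_i\delta_i}$, $\mathrm{FNP}(\delta^n)=\frac{\sum_i(1-\delta_i)\theta_i}{1\vee\sum_i(1-\delta_i)}$, $\mathrm{FNR}(\delta^n)=\mathbb E[\mathrm{FNP}(\delta^n)]$. Functions $a,b,b^*$: let $W=\pi_0f_0(X)/f(X)$ with $X\sim f$, $G(t)=\mathbb P(W\le t)$, $G^{-1}(u)=\inf\{t\in[0,1]:G(t)\ge u\}$ for $u\in[0,1]$. For $u\in[0,1]$ choose $p(u)\in[0,1]$ with $\mathbb P(W<G^{-1}(u))+p(u)\mathbb P(W=G^{-1}(u))=u$. Let $S_u=1$ if $W<G^{-1}(u)$, $S_u\sim\mathrm{Bern}(p(u))$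 (independent coin) if $W=G^{-1}(u)$, $S_u=0$ if $W>G^{-1}(u)$; then $S_u\sim\mathrm{Bern}(u)$. Set $a(u)=\mathbb E[W\mid S_u=1]$ for $u\in(0,1]$, $a(0)=0$; $b(u)=\mathbb E[1-W\mid S_u=0]$ for $u\in[0,1)$, $b(1)=0$. For $\alpha\in[0,1]$, $b^*(\alpha)=\inf\{b(u):u\in[0,1],\ a(u)\le\alpha\}$ and $u^*(\alpha)=\sup\{u\in[0,1]:a(u)\le\alpha\}$. Rule $\delta^n_{\rm NP}(\alpha)=(\delta_1,\dots,\delta_n)$: with $W_i=\pi_0f_0(X_i)/f(X_i)$, $\delta_i=1$ if $W_i<G^{-1}(u^*(\alpha))$, $\delta_i\sim\mathrm{Bern}(p(u^*(\alpha)))$ (independent coins over $i$) if $W_i=G^{-1}(u^*(\alpha))$, and $\delta_i=0$ if $W_i>G^{-1}(u^*(\alpha))$. *)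

theory Defs
  imports "HOL-Probability.Probability"
begin

definition prob_density :: "'x measure \<Rightarrow> ('x \<Rightarrow> real) \<Rightarrow> bool" where
  "prob_density \<nu> g \<longleftrightarrow> g \<in> borel_measurable \<nu> \<and> (\<forall>x\<in>space \<nu>. 0 \<le> g x) \<and> (\<integral>\<^sup>+x. ennreal (g x) \<partial>\<nu>) = 1"

text \<open>In what follows \<open>Q\<close> is the law of a single observation and \<open>W\<close> a [0,1]-valued statistic.
  They are instantiated with the mixture law and the posterior null probability.\<close>

definition cdf_W :: "'x measure \<Rightarrow> ('x \<Rightarrow> real) \<Rightarrow> real \<Rightarrow> real" where
  "cdf_W Q W t = \<P>(x in Q. W x \<le> t)"

definition quantile_W :: "'x measure \<Rightarrow> ('x \<Rightarrow> real) \<Rightarrow> real \<Rightarrow> real" where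
  "quantile_W Q W u = Inf {t \<in> {0..1}. u \<le> cdf_W Q W t}"

definition tie_prob :: "'x measure \<Rightarrow> ('x \<Rightarrow> real) \<Rightarrow> (real \<Rightarrow> real) \<Rightarrow> bool" where
  "tie_prob Q W p \<longleftrightarrow> (\<forall>u\<in>{0..1}. p u \<in> {0..1} \<and>
     \<P>(x in Q. W x < quantile_W Q W u) + p u * \<P>(x in Q. W x = quantile_W Q W u) = u)"

definition select_prob :: "'x measure \<Rightarrow> ('x \<Rightarrow> real) \<Rightarrow> (real \<Rightarrow> real) \<Rightarrow> real \<Rightarrow> 'x \<Rightarrow> real" where
  "select_prob Q W p u x =
     (if W x < quantile_W Q W u then 1 else if W x = quantile_W Q W u then p u else 0)"

text \<open>Joint law of \<open>X\<close> and the randomized indicator \<open>S_u\<close>.\<close>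

definition select_law ::
  "'x measure \<Rightarrow> ('x \<Rightarrow> real) \<Rightarrow> (real \<Rightarrow> real) \<Rightarrow> real \<Rightarrow> ('x \<times> bool) measure" where
  "select_law Q W p u = do {
     x \<leftarrow> Q;
     s \<leftarrow> measure_pmf (bernoulli_pmf (select_prob Q W p u x));
     return (Q \<Otimes>\<^sub>M count_space UNIV) (x, s)
   }"

definition cond_expect :: "'y measure \<Rightarrow> ('y \<Rightarrow> real) \<Rightarrow> ('y \<Rightarrow> bool) \<Rightarrow> real" where
  "cond_expect M Y A = (\<integral>y. Y y \<partial>uniform_measure M {y \<in> space M. A y})"

definition a_fun :: "'x measure \<Rightarrow> ('x \<Rightarrow> real) \<Rightarrow> (real \<Rightarrow> real) \<Rightarrow> real \<Rightarrow> real" where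
  "a_fun Q W p u = (if u = 0 then 0
     else cond_expect (select_law Q W p u) (\<lambda>(x, s). W x) (\<lambda>(x, s). s))"

definition b_fun :: "'x measure \<Rightarrow> ('x \<Rightarrow> real) \<Rightarrow> (real \<Rightarrow> real) \<Rightarrow> real \<Rightarrow> real" where
  "b_fun Q W p u = (if u = 1 then 0
     else cond_expect (select_law Q W p u) (\<lambda>(x, s). 1 - W x) (\<lambda>(x, s). \<not> s))"

definition b_star :: "'x measure \<Rightarrow> ('x \<Rightarrow> real) \<Rightarrow> (real \<Rightarrow> real) \<Rightarrow> real \<Rightarrow> real" where
  "b_star Q W p \<alpha> = Inf (b_fun Q W p ` {u \<in> {0..1}. a_fun Q W p u \<le> \<alpha>})"

definition u_star :: "'x measure \<Rightarrow> ('x \<Rightarrow> real) \<Rightarrow> (real \<Rightarrow> real) \<Rightarrow> real \<Rightarrow> real" where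
  "u_star Q W p \<alpha> = Sup {u \<in> {0..1}. a_fun Q W p u \<le> \<alpha>}"


text \<open>Indices range over \<open>{..<n}\<close>; elements of \<open>{0,1}\<^sup>n\<close> are extensional functions into
  \<^typ>\<open>bool\<close>, with \<^const>\<open>True\<close> standing for 1.\<close>

definition decision_rule ::
  "'x measure \<Rightarrow> nat \<Rightarrow> ((nat \<Rightarrow> 'x) \<Rightarrow> (nat \<Rightarrow> bool) measure) \<Rightarrow> bool" where
  "decision_rule \<nu> n K \<longleftrightarrow>
     K \<in> PiM {..<n} (\<lambda>_. \<nu>) \<rightarrow>\<^sub>M prob_algebra (PiM {..<n} (\<lambda>_. count_space UNIV))"

definition np_rule ::
  "'x measure \<Rightarrow> ('x \<Rightarrow> real) \<Rightarrow> (real \<Rightarrow> real) \<Rightarrow> real \<Rightarrow> nat \<Rightarrow> (nat \<Rightarrow> 'x) \<Rightarrow> (nat \<Rightarrow> bool) measure" where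
  "np_rule Q W p \<alpha> n X =
     PiM {..<n} (\<lambda>i. measure_pmf (bernoulli_pmf (select_prob Q W p (u_star Q W p \<alpha>) (X i))))"

definition label_configs :: "nat \<Rightarrow> nat \<Rightarrow> (nat \<Rightarrow> bool) set" where
  "label_configs n m = {\<theta> \<in> {..<n} \<rightarrow>\<^sub>E UNIV. (\<Sum>i<n. of_bool (\<theta> i)) = m}"

text \<open>Joint law of labels, observations and decisions. The kernel \<open>K\<close> sees only \<open>X\<close>, so the
  decisions are conditionally independent of the labels given the observations.\<close>

definition fixed_prop_law ::
  "'x measure \<Rightarrow> ('x \<Rightarrow> real) \<Rightarrow> ('x \<Rightarrow> real) \<Rightarrow> nat \<Rightarrow> nat \<Rightarrow>
   ((nat \<Rightarrow> 'x) \<Rightarrow> (nat \<Rightarrow> bool) measure) \<Rightarrow>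
   ((nat \<Rightarrow> bool) \<times> (nat \<Rightarrow> 'x) \<times> (nat \<Rightarrow> bool)) measure" where
  "fixed_prop_law \<nu> f0 f1 n m K = do {
     \<theta> \<leftarrow> measure_pmf (pmf_of_set (label_configs n m));
     X \<leftarrow> PiM {..<n} (\<lambda>i. density \<nu> (\<lambda>x. ennreal (if \<theta> i then f1 x else f0 x)));
     d \<leftarrow> K X;
     return (count_space UNIV \<Otimes>\<^sub>M PiM {..<n} (\<lambda>_. \<nu>) \<Otimes>\<^sub>M PiM {..<n} (\<lambda>_. count_space UNIV))
       (\<theta>, X, d)
   }"

definition FDP :: "nat \<Rightarrow> (nat \<Rightarrow> bool) \<Rightarrow> (nat \<Rightarrow> bool) \<Rightarrow> real" where
  "FDP n \<theta> d = (\<Sum>i<n. of_bool (d i) * (1 - of_bool (\<theta> i))) / max 1 (\<Sum>i<n. of_bool (d i))"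

definition FNP :: "nat \<Rightarrow> (nat \<Rightarrow> bool) \<Rightarrow> (nat \<Rightarrow> bool) \<Rightarrow> real" where
  "FNP n \<theta> d =
     (\<Sum>i<n. (1 - of_bool (d i)) * of_bool (\<theta> i)) / max 1 (\<Sum>i<n. 1 - of_bool (d i))"

definition FNR :: "nat \<Rightarrow> ((nat \<Rightarrow> bool) \<times> (nat \<Rightarrow> 'x) \<times> (nat \<Rightarrow> bool)) measure \<Rightarrow> real" where
  "FNR n M = (\<integral>(\<theta>, X, d). FNP n \<theta> d \<partial>M)"

end

theory Submission
  imports Defs
begin

text \<open>
  With independent labels of non-null probability \<open>\<pi>1\<close>, the labels are, given observations and
  decisions, independent with null probabilities \<open>W (X i)\<close>, so exponential moments of
  \<open>\<Sum>i. z (\<theta> i) (d i)\<close> are computed by integrating out the labels; this works for any decision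
  kernel. The fixed-proportion model is this model conditioned on the number of non-nulls being
  \<open>n1 n\<close>. As \<open>n1 n / n \<longrightarrow> \<pi>1\<close>, that event has probability at least \<open>c^n\<close> eventually, for each
  \<open>c < 1\<close>, hence exponentially small probabilities stay small after conditioning.

  Let \<open>R u\<close> be the least value of \<open>\<integral> W \<phi>\<close> over selection functions \<open>\<phi>\<close> of mass \<open>u\<close>
  (Neyman-Pearson); it is convex with slope \<open>q u\<close>, the quantile of \<open>W\<close>, and
  \<open>a u = R u / u\<close>, \<open>b u = (\<pi>1 - u + R u) / (1 - u)\<close>. For (i), linear statistics with
  negative drift bound the two ratios. For (ii), a rule with \<open>r n\<close> rejections makes, up to
  \<open>\<epsilon> n\<close>, at least \<open>n (R u + q u (r - u))\<close> false discoveries; for \<open>u\<close> slightly above \<open>u\<^sup>*\<close> this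
  single supporting line and \<open>FDP \<le> \<alpha>\<close> force \<open>r < u\<close>, and then \<open>FNP \<ge> b u\<close> up to small errors.
\<close>

section \<open>Conditioning on the number of non-nulls\<close>

text \<open>If \<open>k \<le> m\<close>, then \<open>fact m / fact k\<close> is a product of
  \<open>m - k\<close> factors, each at most \<open>m\<close>; if \<open>k > m\<close>, then
  \<open>fact k / fact m\<close> is a product of \<open>k - m\<close> factors, each greater than
  \<open>m\<close>. Both cases are inductions on the distance of \<open>k\<close> and
  \<open>m\<close>.\<close>

lemma fact_mult_power_le: "fact m * m ^ k \<le> (fact k * m ^ m :: nat)"
proof (cases "k \<le> m")
  case True
  have "fact (k + d) * (m::nat) ^ k \<le> fact k * m ^ (k + d)" if "k + d \<le> m" for d
    using that
  proof (induction d)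
    case (Suc d)
    then have IH: "fact (k + d) * m ^ k \<le> fact k * m ^ (k + d)" by simp
    have "(k + Suc d) * (fact (k + d) * m ^ k) \<le> m * (fact k * m ^ (k + d))"
      using Suc.prems by (intro mult_le_mono IH) auto
    then show ?case by (simp add: algebra_simps)
  qed simp
  from this[of "m - k"] True show ?thesis by simp
next
  case False
  have "fact m * (m::nat) ^ (m + d) \<le> fact (m + d) * m ^ m" for d
  proof (induction d)
    case (Suc d)
    have "m * (fact m * m ^ (m + d)) \<le> (m + Suc d) * (fact (m + d) * m ^ m)"
      by (intro mult_le_mono Suc.IH) auto
    then show ?case by (simp add: algebra_simps)
  qed simp
  from this[of "k - m"] False show ?thesis by simp
qed

text \<open>The mode of the binomial law with parameters \<open>n\<close> and \<open>m/n\<close> is at \<open>m\<close>.\<close>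

lemma power_le_binomial_mode:
  assumes "m \<le> n"
  shows "n ^ n \<le> (n + 1) * ((n choose m) * m ^ m * (n - m) ^ (n - m))"
proof -
  define j where "j = n - m"
  \<comment> \<open>Multiplying by all four factorials turns both binomial coefficients into
    \<open>fact n\<close>; what remains is the product of two instances of
    \<open>fact_mult_power_le\<close>, one for \<open>m\<close> and one for
    \<open>j\<close>.\<close>
  have "(n choose k) * m ^ k * j ^ (n - k) \<le> (n choose m) * m ^ m * j ^ j" if "k \<le> n" for k
  proof -
    have "((n choose k) * m ^ k * j ^ (n - k)) * (fact m * fact j * (fact k * fact (n - k)))
        = ((n choose k) * fact k * fact (n - k)) * (fact m * m ^ k) * (fact j * j ^ (n - k))"
      by (simp add: algebra_simps)
    also have "\<dots> = fact n * (fact m * m ^ k) * (fact j * j ^ (n - k))"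
      using binomial_fact_lemma[OF that] by (simp add: algebra_simps)
    also have "\<dots> \<le> fact n * (fact k * m ^ m) * (fact (n - k) * j ^ j)"
      by (intro mult_mono fact_mult_power_le) auto
    also have "\<dots> = (fact m * fact j * (n choose m)) * (fact k * m ^ m) * (fact (n - k) * j ^ j)"
      using binomial_fact_lemma[OF assms] unfolding j_def by metis
    also have "\<dots> = ((n choose m) * m ^ m * j ^ j) * (fact m * fact j * (fact k * fact (n - k)))"
      by (simp add: algebra_simps)
    finally show ?thesis by simp
  qed
  \<comment> \<open>The \<open>n + 1\<close> binomial terms add up to
    \<open>(m + j) ^ n = n ^ n\<close>, and each is at most the mode term.\<close>
  then have "(\<Sum>k\<le>n. (n choose k) * m ^ k * j ^ (n - k)) \<le> (\<Sum>k\<le>n. (n choose m) * m ^ m * j ^ j)"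
    by (intro sum_mono) auto
  moreover have "n ^ n = (\<Sum>k\<le>n. (n choose k) * m ^ k * j ^ (n - k))"
    using binomial_ring[of m "n - m" n] assms by (simp add: j_def)
  ultimately show ?thesis by (simp add: j_def[symmetric])
qed

text \<open>The denominator is the binomial probability of \<open>m n\<close> successes. By the mode
  bound, and since \<open>m n / n\<close> is close to \<open>\<pi>1\<close>, it is eventually at
  least \<open>1 / ((n + 1) * c ^ n)\<close> for any \<open>c > 1\<close>, so the quotient is at
  most \<open>(n + 1) * (c * \<rho>) ^ n\<close>.\<close>

lemma exponential_beats_type_probability:
  fixes \<pi>0 \<pi>1 \<rho> :: real
  assumes \<pi>: "0 < \<pi>0" "0 < \<pi>1" "\<pi>0 + \<pi>1 = 1" and \<rho>: "0 \<le> \<rho>" "\<rho> < 1"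
    and m: "\<forall>n\<ge>1. m n \<le> n" "(\<lambda>n. real (m n) / real n) \<longlonglongrightarrow> \<pi>1"
  shows "(\<lambda>n. \<rho> ^ n / (real (n choose m n) * \<pi>1 ^ m n * \<pi>0 ^ (n - m n))) \<longlonglongrightarrow> 0"
proof -
  \<comment> \<open>The midpoint of 1 and \<open>1 / \<rho>\<close> gives both \<open>c > 1\<close>
    and \<open>c * \<rho> < 1\<close>; for \<open>\<rho> = 0\<close> any \<open>c > 1\<close>
    serves.\<close>
  define c where "c = (if \<rho> = 0 then 2 else (1 + 1 / \<rho>) / 2)"
  have c: "c > 1" "c * \<rho> < 1"
    using \<rho> by (auto simp: c_def field_simps)
  have l1: "(\<lambda>n. real (m n) / real n / \<pi>1) \<longlonglongrightarrow> 1"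
    using tendsto_divide[OF m(2) tendsto_const[of \<pi>1]] \<pi> by simp
  have "(\<lambda>n. (1 - real (m n) / real n) / \<pi>0) \<longlonglongrightarrow> (1 - \<pi>1) / \<pi>0"
    using \<pi> by (intro tendsto_intros m(2)) auto
  moreover have "(1 - \<pi>1) / \<pi>0 = 1" using \<pi> by (simp add: field_simps)
  ultimately have l0: "(\<lambda>n. (1 - real (m n) / real n) / \<pi>0) \<longlonglongrightarrow> 1" by simp
  have ev: "\<forall>\<^sub>F n in sequentially.
      \<rho> ^ n / (real (n choose m n) * \<pi>1 ^ m n * \<pi>0 ^ (n - m n)) \<le> (real n + 1) * (c * \<rho>) ^ n"
    using order_tendstoD(2)[OF l1 c(1)] order_tendstoD(2)[OF l0 c(1)] eventually_ge_at_top[of 1]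
  proof eventually_elim
    case (elim n)
    define k where "k = m n"
    define j where "j = n - k"
    have kn: "k \<le> n" "n > 0" using m(1) elim by (auto simp: k_def)
    have nkj: "real n = real k + real j" "n = k + j" using kn by (auto simp: j_def)
    define B where "B = real (n choose k)"
    have Bpos: "B > 0" using kn by (simp add: B_def)
    have k1: "real k \<le> c * \<pi>1 * real n"
      using elim(1) kn \<pi> by (simp add: k_def[symmetric] pos_divide_less_eq ac_simps)
    have "1 - real k / real n = real j / real n"
      using nkj(1) kn by (simp add: diff_divide_eq_iff del: of_nat_add)
    then have "real j / real n / \<pi>0 < c" using elim(2) by (simp add: k_def)
    then have j1: "real j \<le> c * \<pi>0 * real n"
      using kn \<pi> by (simp add: pos_divide_less_eq ac_simps)
    have "real (n ^ n) \<le> real ((n + 1) * ((n choose k) * k ^ k * j ^ j))"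
      unfolding j_def by (rule of_nat_mono[OF power_le_binomial_mode[OF kn(1)]])
    also have "\<dots> = (real n + 1) * (B * real k ^ k * real j ^ j)"
      by (simp add: B_def distrib_right)
    also have "\<dots> \<le> (real n + 1) * (B * (c * \<pi>1 * real n) ^ k * (c * \<pi>0 * real n) ^ j)"
      using k1 j1 Bpos c(1) \<pi> by (intro mult_left_mono mult_mono power_mono) auto
    also have "\<dots> = (real n + 1) * (c ^ k * c ^ j) * (B * \<pi>1 ^ k * \<pi>0 ^ j) * (real n ^ k * real n ^ j)"
      by (simp only: power_mult_distrib ac_simps)
    also have "\<dots> = ((real n + 1) * c ^ n * (B * \<pi>1 ^ k * \<pi>0 ^ j)) * real (n ^ n)"
      unfolding power_add[symmetric] nkj(2)[symmetric] by (simp add: ac_simps)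
    finally have "1 * real (n ^ n) \<le> ((real n + 1) * c ^ n * (B * \<pi>1 ^ k * \<pi>0 ^ j)) * real (n ^ n)"
      by simp
    moreover have "0 < real (n ^ n)" using kn by simp
    ultimately have "1 \<le> (real n + 1) * c ^ n * (B * \<pi>1 ^ k * \<pi>0 ^ j)"
      by (simp only: mult_le_cancel_right_pos)
    then have "\<rho> ^ n * 1 \<le> \<rho> ^ n * ((real n + 1) * c ^ n * (B * \<pi>1 ^ k * \<pi>0 ^ j))"
      using \<rho> by (intro mult_left_mono) auto
    also have "\<dots> = (real n + 1) * (c * \<rho>) ^ n * (B * \<pi>1 ^ k * \<pi>0 ^ j)"
      by (simp only: power_mult_distrib ac_simps)
    finally have "\<rho> ^ n \<le> (real n + 1) * (c * \<rho>) ^ n * (B * \<pi>1 ^ k * \<pi>0 ^ j)" by simp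
    moreover have "0 < B * \<pi>1 ^ k * \<pi>0 ^ j" using Bpos \<pi> by simp
    ultimately show ?case
      unfolding B_def j_def k_def by (simp only: pos_divide_le_eq)
  qed
  have q: "\<bar>c * \<rho>\<bar> < 1" using c \<rho> by simp
  have "(\<lambda>n. real n * (c * \<rho>) ^ n + (c * \<rho>) ^ n) \<longlonglongrightarrow> 0 + 0"
    using powser_times_n_limit_0[of "c * \<rho>"] LIMSEQ_abs_realpow_zero2[OF q] q
    by (intro tendsto_add) auto
  then have "(\<lambda>n. (real n + 1) * (c * \<rho>) ^ n) \<longlonglongrightarrow> 0" by (simp add: algebra_simps)
  then show ?thesis
    using \<rho> \<pi> by (intro tendsto_sandwich[OF _ ev tendsto_const]) auto
qed

section \<open>Product measures: densities and Bernoulli kernels\<close>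

lemma PiM_density:
  fixes Q :: "'a measure" and h :: "'i \<Rightarrow> 'a \<Rightarrow> ennreal"
  assumes I: "finite I" and Q: "prob_space Q"
    and h[measurable]: "\<And>i. h i \<in> borel_measurable Q"
    and D: "\<And>i. prob_space (density Q (h i))"
  shows "PiM I (\<lambda>i. density Q (h i)) = density (PiM I (\<lambda>_. Q)) (\<lambda>x. \<Prod>i\<in>I. h i (x i))"
proof -
  interpret D: product_sigma_finite "\<lambda>i. density Q (h i)"
    unfolding product_sigma_finite_def using D prob_space_imp_sigma_finite by blast
  interpret Q: product_sigma_finite "\<lambda>_::'i. Q"
    unfolding product_sigma_finite_def using Q prob_space_imp_sigma_finite by blast
  show ?thesis
  \<comment> \<open>It suffices to compare the measures on boxes, where the integrand factors over
    the coordinates.\<close>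
  proof (rule D.PiM_eqI[OF I, symmetric])
    show "sets (density (PiM I (\<lambda>_. Q)) (\<lambda>x. \<Prod>i\<in>I. h i (x i))) = sets (PiM I (\<lambda>i. density Q (h i)))"
      by (simp cong: sets_PiM_cong)
    fix A assume A: "\<And>i. i \<in> I \<Longrightarrow> A i \<in> sets (density Q (h i))"
    then have A'[measurable]: "\<And>i. i \<in> I \<Longrightarrow> A i \<in> sets Q" by simp
    have "emeasure (density (PiM I (\<lambda>_. Q)) (\<lambda>x. \<Prod>i\<in>I. h i (x i))) (Pi\<^sub>E I A)
        = (\<integral>\<^sup>+x. (\<Prod>i\<in>I. h i (x i)) * indicator (Pi\<^sub>E I A) x \<partial>PiM I (\<lambda>_. Q))"
      using I A' by (intro emeasure_density) (auto intro!: sets_PiM_I_finite)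
    also have "\<dots> = (\<integral>\<^sup>+x. (\<Prod>i\<in>I. h i (x i) * indicator (A i) (x i)) \<partial>PiM I (\<lambda>_. Q))"
      using I by (intro nn_integral_cong)
        (auto simp: prod.distrib indicator_def space_PiM PiE_iff intro!: prod.neutral)
    also have "\<dots> = (\<Prod>i\<in>I. \<integral>\<^sup>+x. h i x * indicator (A i) x \<partial>Q)"
      using I A' by (intro Q.product_nn_integral_prod) auto
    also have "\<dots> = (\<Prod>i\<in>I. emeasure (density Q (h i)) (A i))"
      using A' by (intro prod.cong) (auto simp: emeasure_density)
    finally show "emeasure (density (PiM I (\<lambda>_. Q)) (\<lambda>x. \<Prod>i\<in>I. h i (x i))) (Pi\<^sub>E I A)
        = (\<Prod>i\<in>I. emeasure (density Q (h i)) (A i))" .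
  qed
qed

text \<open>Boxes form an intersection-stable generator, so measurability of the kernel is tested on
  boxes only; there the probability is a finite product of affine functions of the
  \<open>g i x\<close>. This is what makes the threshold rule a decision rule.\<close>

lemma PiM_bernoulli_kernel:
  fixes g :: "'i \<Rightarrow> 'x \<Rightarrow> real"
  assumes I: "finite I" and g: "\<And>i. i \<in> I \<Longrightarrow> g i \<in> borel_measurable N"
    and g01: "\<And>i x. i \<in> I \<Longrightarrow> x \<in> space N \<Longrightarrow> g i x \<in> {0..1}"
  shows "(\<lambda>x. PiM I (\<lambda>i. measure_pmf (bernoulli_pmf (g i x))))
    \<in> N \<rightarrow>\<^sub>M prob_algebra (PiM I (\<lambda>_. count_space UNIV))"
proof (rule measurable_prob_algebra_generated[OF sets_PiM Int_stable_prod_algebra])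
  show "prod_algebra I (\<lambda>_. count_space UNIV) \<subseteq> Pow (\<Pi>\<^sub>E i\<in>I. space (count_space (UNIV :: bool set)))"
    by (rule prod_algebra_sets_into_space)
  show "prob_space (PiM I (\<lambda>i. measure_pmf (bernoulli_pmf (g i x))))" for x
    by (intro prob_space_PiM measure_pmf.prob_space_axioms)
  show "sets (PiM I (\<lambda>i. measure_pmf (bernoulli_pmf (g i x)))) = sets (PiM I (\<lambda>_. count_space UNIV))" for x
    by (intro sets_PiM_cong) auto
  fix A assume "A \<in> prod_algebra I (\<lambda>_. count_space (UNIV :: bool set))"
  then obtain B where A: "A = Pi\<^sub>E I B"
    unfolding prod_algebra_eq_finite[OF I] by auto
  have "emeasure (PiM I (\<lambda>i. measure_pmf (bernoulli_pmf (g i x)))) A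
      = (\<Prod>i\<in>I. indicator (B i) True * ennreal (g i x) + indicator (B i) False * ennreal (1 - g i x))"
    if x: "x \<in> space N" for x
  proof -
    interpret product_prob_space "\<lambda>i. measure_pmf (bernoulli_pmf (g i x))" I
      by unfold_locales
    have "emeasure (PiM I (\<lambda>i. measure_pmf (bernoulli_pmf (g i x)))) A
        = (\<Prod>i\<in>I. emeasure (measure_pmf (bernoulli_pmf (g i x))) (B i))"
      unfolding A using I by (intro emeasure_PiM) auto
    also have "\<dots> = (\<Prod>i\<in>I. \<integral>\<^sup>+s. indicator (B i) s \<partial>measure_pmf (bernoulli_pmf (g i x)))"
      by simp
    also have "\<dots> = (\<Prod>i\<in>I. indicator (B i) True * ennreal (g i x) + indicator (B i) False * ennreal (1 - g i x))"
      using g01[OF _ x] by (intro prod.cong refl nn_integral_bernoulli_pmf) auto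
    finally show ?thesis .
  qed
  moreover have "(\<lambda>x. indicator (B i) True * ennreal (g i x) + indicator (B i) False * ennreal (1 - g i x))
      \<in> borel_measurable N" if "i \<in> I" for i
    using g[OF that] by measurable
  ultimately show "(\<lambda>x. emeasure (PiM I (\<lambda>i. measure_pmf (bernoulli_pmf (g i x)))) A) \<in> borel_measurable N"
    using I by (simp cong: measurable_cong add: borel_measurable_prod)
qed

section \<open>Label configurations with a given number of non-nulls\<close>

lemma label_configs_eq:
  "label_configs n m = (\<lambda>S. \<lambda>i\<in>{..<n}. i \<in> S) ` {S. S \<subseteq> {..<n} \<and> card S = m}"
proof (intro equalityI subsetI)
  fix \<theta> assume \<theta>: "\<theta> \<in> label_configs n m"
  have "(\<Sum>i<n. of_bool (\<theta> i) :: nat) = card {i \<in> {..<n}. \<theta> i}"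
    by (simp add: of_bool_def sum.If_cases Int_def)
  with \<theta> have "card {i \<in> {..<n}. \<theta> i} = m" by (simp add: label_configs_def)
  moreover have "\<theta> = (\<lambda>i\<in>{..<n}. i \<in> {i \<in> {..<n}. \<theta> i})"
    using \<theta> by (auto simp: label_configs_def fun_eq_iff PiE_def extensional_def)
  ultimately show "\<theta> \<in> (\<lambda>S. \<lambda>i\<in>{..<n}. i \<in> S) ` {S. S \<subseteq> {..<n} \<and> card S = m}" by blast
next
  fix \<theta> assume "\<theta> \<in> (\<lambda>S. \<lambda>i\<in>{..<n}. i \<in> S) ` {S. S \<subseteq> {..<n} \<and> card S = m}"
  then obtain S where S: "S \<subseteq> {..<n}" "card S = m" "\<theta> = (\<lambda>i\<in>{..<n}. i \<in> S)" by auto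
  have "(\<Sum>i<n. of_bool (\<theta> i) :: nat) = (\<Sum>i<n. of_bool (i \<in> S))"
    unfolding S(3) by (intro sum.cong) auto
  also have "\<dots> = card ({..<n} \<inter> S)" by (simp add: of_bool_def sum.If_cases Int_def)
  also have "\<dots> = m" using S by (simp add: Int_absorb1)
  finally have "(\<Sum>i<n. of_bool (\<theta> i) :: nat) = m" .
  moreover have "\<theta> \<in> {..<n} \<rightarrow>\<^sub>E UNIV" using S(3) by auto
  ultimately show "\<theta> \<in> label_configs n m"
    unfolding label_configs_def by blast
qed

lemma card_label_configs: "card (label_configs n m) = n choose m"
proof -
  have "inj_on (\<lambda>S. \<lambda>i\<in>{..<n}. i \<in> S) {S. S \<subseteq> {..<n} \<and> card S = m}"
  proof (rule inj_onI)
    fix S T assume S: "S \<in> {S. S \<subseteq> {..<n} \<and> card S = m}" and T: "T \<in> {S. S \<subseteq> {..<n} \<and> card S = m}"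
      and eq: "(\<lambda>i\<in>{..<n}. i \<in> S) = (\<lambda>i\<in>{..<n}. i \<in> T)"
    have "i \<in> S \<longleftrightarrow> i \<in> T" if "i < n" for i
      using fun_cong[OF eq, of i] that by simp
    with S T show "S = T" by auto
  qed
  then show ?thesis
    by (simp add: label_configs_eq card_image n_subsets)
qed

lemma finite_label_configs: "finite (label_configs n m)"
  by (simp add: label_configs_eq)

lemma label_configs_nonempty: "m \<le> n \<Longrightarrow> label_configs n m \<noteq> {}"
  using card_label_configs[of n m] zero_less_binomial[of m n] by auto

lemma label_configs_sum:
  assumes "\<theta> \<in> label_configs n m"
  shows "(\<Sum>i<n. of_bool (\<theta> i) :: real) = real m"
proof -
  have "(\<Sum>i<n. of_bool (\<theta> i) :: nat) = m" using assms by (simp add: label_configs_def)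
  then have "real (\<Sum>i<n. of_bool (\<theta> i) :: nat) = real m" by simp
  then show ?thesis by simp
qed

text \<open>Independent labels give all configurations with \<open>m\<close> non-nulls the same
  weight, so conditioning them on the number of non-nulls yields the uniform law.\<close>

lemma label_configs_prod_prior:
  fixes a b :: "'a :: comm_semiring_1"
  assumes "\<theta> \<in> label_configs n m"
  shows "(\<Prod>i<n. if \<theta> i then a else b) = a ^ m * b ^ (n - m)"
proof -
  have s: "(\<Sum>i<n. of_bool (\<theta> i) :: nat) = card {i \<in> {..<n}. \<theta> i}"
    by (simp add: of_bool_def sum.If_cases Int_def)
  then have c: "card {i \<in> {..<n}. \<theta> i} = m" using assms by (simp add: label_configs_def)
  have "card {i \<in> {..<n}. \<not> \<theta> i} = n - m"
  proof -
    have "{i \<in> {..<n}. \<not> \<theta> i} = {..<n} - {i \<in> {..<n}. \<theta> i}" by auto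
    then show ?thesis using c by (simp only:) (subst card_Diff_subset; auto)
  qed
  with c show ?thesis by (simp add: prod.If_cases Int_def)
qed

section \<open>The fixed-proportion law\<close>

lemma prob_space_density_prob_density: "prob_density \<nu> g \<Longrightarrow> prob_space (density \<nu> (\<lambda>x. ennreal (g x)))"
  by (intro prob_spaceI) (simp add: prob_density_def emeasure_density cong: nn_integral_cong)

text \<open>All three claims rest on measurability of the nested kernels \<open>k1\<close> and
  \<open>k2\<close>, so they are proved together. The integral formula is the form in which the law
  is used later: an average over configurations of integrals over observations and
  decisions.\<close>

lemma fixed_prop_law_properties:
  fixes \<nu> :: "'x measure" and n m :: nat
  defines "S \<equiv> count_space (UNIV :: (nat \<Rightarrow> bool) set) \<Otimes>\<^sub>M PiM {..<n} (\<lambda>_. \<nu>) \<Otimes>\<^sub>M PiM {..<n} (\<lambda>_. count_space (UNIV :: bool set))"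
  assumes f0: "prob_density \<nu> f0" and f1: "prob_density \<nu> f1" and "m \<le> n" and K: "decision_rule \<nu> n K"
  shows prob_space_fixed_prop_law: "prob_space (fixed_prop_law \<nu> f0 f1 n m K)"
    and sets_fixed_prop_law: "sets (fixed_prop_law \<nu> f0 f1 n m K) = sets S"
    and nn_integral_fixed_prop_law: "g \<in> borel_measurable S \<Longrightarrow>
      (\<integral>\<^sup>+\<omega>. g \<omega> \<partial>fixed_prop_law \<nu> f0 f1 n m K) =
        (\<Sum>\<theta>\<in>label_configs n m. \<integral>\<^sup>+X. \<integral>\<^sup>+d. g (\<theta>, X, d) \<partial>K X
          \<partial>PiM {..<n} (\<lambda>i. density \<nu> (\<lambda>x. ennreal (if \<theta> i then f1 x else f0 x)))) / (n choose m)"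
proof -
  define M where "M \<theta> = PiM {..<n} (\<lambda>i. density \<nu> (\<lambda>x. ennreal (if \<theta> i then f1 x else f0 x)))" for \<theta> :: "nat \<Rightarrow> bool"
  have M_sets[measurable_cong]: "sets (M \<theta>) = sets (PiM {..<n} (\<lambda>_. \<nu>))" for \<theta>
    unfolding M_def by (intro sets_PiM_cong) auto
  have M_prob: "prob_space (M \<theta>)" for \<theta>
    unfolding M_def
    using prob_space_density_prob_density[OF f0] prob_space_density_prob_density[OF f1]
    by (intro prob_space_PiM, rename_tac i, case_tac "\<theta> i") simp_all
  have K0: "K \<in> PiM {..<n} (\<lambda>_. \<nu>) \<rightarrow>\<^sub>M prob_algebra (PiM {..<n} (\<lambda>_. count_space UNIV))"
    using K by (simp add: decision_rule_def)
  note K1[measurable] = measurable_prob_algebraD[OF K0]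
  have K_sets: "sets (K X) = sets (PiM {..<n} (\<lambda>_. count_space UNIV))"
    and K_prob: "prob_space (K X)" if "X \<in> space (PiM {..<n} (\<lambda>_. \<nu>))" for X
    using measurable_space[OF K0 that] by (auto simp: space_prob_algebra)
  have M_space: "space (M \<theta>) = space (PiM {..<n} (\<lambda>_. \<nu>))" for \<theta>
    by (rule sets_eq_imp_space_eq[OF M_sets])
  define k2 where "k2 \<theta> X = K X \<bind> (\<lambda>d. return S (\<theta>, X, d))" for \<theta> X
  have k2[measurable]: "k2 \<theta> \<in> M \<theta> \<rightarrow>\<^sub>M subprob_algebra S" for \<theta>
    unfolding k2_def S_def by measurable
  define k1 where "k1 \<theta> = M \<theta> \<bind> k2 \<theta>" for \<theta>
  have law: "fixed_prop_law \<nu> f0 f1 n m K = measure_pmf (pmf_of_set (label_configs n m)) \<bind> k1"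
    unfolding fixed_prop_law_def k1_def k2_def M_def S_def by simp
  have k2_prob: "prob_space (k2 \<theta> X)" if X: "X \<in> space (M \<theta>)" for \<theta> X
    unfolding k2_def
  proof (rule prob_space.prob_space_bind[OF K_prob])
    show "X \<in> space (PiM {..<n} (\<lambda>_. \<nu>))" using X by (simp add: M_space)
    then show "AE d in K X. prob_space (return S (\<theta>, X, d))"
      using K_sets[THEN sets_eq_imp_space_eq] X
      by (intro AE_I2 prob_space_return) (auto simp: S_def space_pair_measure)
    show "(\<lambda>d. return S (\<theta>, X, d)) \<in> K X \<rightarrow>\<^sub>M subprob_algebra S"
      using X unfolding M_space by (simp add: S_def K_sets cong: measurable_cong_sets)
  qed
  have k1_prob: "prob_space (k1 \<theta>)" for \<theta>
    unfolding k1_def by (rule prob_space.prob_space_bind[OF M_prob _ k2]) (auto intro: k2_prob)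
  have k1_sets: "sets (k1 \<theta>) = sets S" for \<theta>
    unfolding k1_def by (rule sets_bind[OF sets_kernel[OF k2] prob_space.not_empty[OF M_prob]])
  \<comment> \<open>Labels carry the discrete sigma-algebra, so only the values of the kernel have
    to be checked.\<close>
  have k1: "k1 \<in> measure_pmf (pmf_of_set (label_configs n m)) \<rightarrow>\<^sub>M subprob_algebra S"
    using k1_prob k1_sets by (auto simp: space_subprob_algebra prob_space_imp_subprob_space)
  show "prob_space (fixed_prop_law \<nu> f0 f1 n m K)"
    unfolding law by (rule prob_space.prob_space_bind[OF measure_pmf.prob_space_axioms _ k1]) (auto intro: k1_prob)
  show "sets (fixed_prop_law \<nu> f0 f1 n m K) = sets S"
    unfolding law by (rule sets_bind) (auto simp: k1_sets)
  assume g[measurable]: "g \<in> borel_measurable S"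
  have k1_integral: "(\<integral>\<^sup>+\<omega>. g \<omega> \<partial>k1 \<theta>) = (\<integral>\<^sup>+X. \<integral>\<^sup>+d. g (\<theta>, X, d) \<partial>K X \<partial>M \<theta>)" for \<theta>
  proof -
    have "(\<integral>\<^sup>+\<omega>. g \<omega> \<partial>k1 \<theta>) = (\<integral>\<^sup>+X. \<integral>\<^sup>+\<omega>. g \<omega> \<partial>k2 \<theta> X \<partial>M \<theta>)"
      unfolding k1_def by (rule nn_integral_bind[OF g k2])
    also have "\<dots> = (\<integral>\<^sup>+X. \<integral>\<^sup>+d. g (\<theta>, X, d) \<partial>K X \<partial>M \<theta>)"
    proof (rule nn_integral_cong)
      fix X assume "X \<in> space (M \<theta>)"
      then have X: "X \<in> space (PiM {..<n} (\<lambda>_. \<nu>))" by (simp add: M_space)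
      have "(\<integral>\<^sup>+\<omega>. g \<omega> \<partial>k2 \<theta> X) = (\<integral>\<^sup>+d. \<integral>\<^sup>+\<omega>. g \<omega> \<partial>return S (\<theta>, X, d) \<partial>K X)"
        unfolding k2_def using X
        by (intro nn_integral_bind[OF g]) (simp add: S_def K_sets cong: measurable_cong_sets)
      also have "\<dots> = (\<integral>\<^sup>+d. g (\<theta>, X, d) \<partial>K X)"
        using X K_sets[OF X, THEN sets_eq_imp_space_eq]
        by (intro nn_integral_cong nn_integral_return g) (auto simp: S_def space_pair_measure)
      finally show "(\<integral>\<^sup>+\<omega>. g \<omega> \<partial>k2 \<theta> X) = (\<integral>\<^sup>+d. g (\<theta>, X, d) \<partial>K X)" .
    qed
    finally show ?thesis .
  qed
  have "(\<integral>\<^sup>+\<omega>. g \<omega> \<partial>fixed_prop_law \<nu> f0 f1 n m K)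
      = (\<integral>\<^sup>+\<theta>. \<integral>\<^sup>+\<omega>. g \<omega> \<partial>k1 \<theta> \<partial>measure_pmf (pmf_of_set (label_configs n m)))"
    unfolding law by (rule nn_integral_bind[OF g k1])
  also have "\<dots> = (\<Sum>\<theta>\<in>label_configs n m. \<integral>\<^sup>+\<omega>. g \<omega> \<partial>k1 \<theta>) / (n choose m)"
    using finite_label_configs label_configs_nonempty[OF \<open>m \<le> n\<close>]
    by (simp add: nn_integral_pmf_of_set card_label_configs)
  finally show "(\<integral>\<^sup>+\<omega>. g \<omega> \<partial>fixed_prop_law \<nu> f0 f1 n m K) =
        (\<Sum>\<theta>\<in>label_configs n m. \<integral>\<^sup>+X. \<integral>\<^sup>+d. g (\<theta>, X, d) \<partial>K X
          \<partial>PiM {..<n} (\<lambda>i. density \<nu> (\<lambda>x. ennreal (if \<theta> i then f1 x else f0 x)))) / (n choose m)"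
    by (simp add: M_def k1_integral)
qed

text \<open>Labels are discrete, and the decision space is finite, so its product sigma-algebra is
  discrete too; functions of labels and decisions are therefore measurable whatever their
  form.\<close>

lemma label_decision_measurable:
  fixes g :: "(nat \<Rightarrow> bool) \<Rightarrow> (nat \<Rightarrow> bool) \<Rightarrow> 'b"
  assumes "\<And>\<theta> d. g \<theta> d \<in> space N"
  shows "(\<lambda>(\<theta>, X, d). g \<theta> d)
    \<in> count_space UNIV \<Otimes>\<^sub>M PiM {..<n} (\<lambda>_. \<nu>) \<Otimes>\<^sub>M PiM {..<n} (\<lambda>_. count_space UNIV) \<rightarrow>\<^sub>M N"
proof -
  have PiM: "PiM {..<n} (\<lambda>_. count_space (UNIV :: bool set)) = count_space (PiE {..<n} (\<lambda>_. UNIV))"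
    by (rule count_space_PiM_finite) auto
  have fin: "finite (PiE {..<n} (\<lambda>_. UNIV :: bool set))" by (intro finite_PiE) auto
  have "(\<lambda>\<omega>. g (fst \<omega>) (snd (snd \<omega>)))
    \<in> count_space UNIV \<Otimes>\<^sub>M PiM {..<n} (\<lambda>_. \<nu>) \<Otimes>\<^sub>M PiM {..<n} (\<lambda>_. count_space UNIV) \<rightarrow>\<^sub>M N"
  proof (rule measurable_compose_countable'[where f="\<lambda>d \<omega>. g (fst \<omega>) d" and g="\<lambda>\<omega>. snd (snd \<omega>)" and I="PiE {..<n} (\<lambda>_. UNIV)"])
    show "(\<lambda>\<omega>. g (fst \<omega>) d) \<in> count_space UNIV \<Otimes>\<^sub>M PiM {..<n} (\<lambda>_. \<nu>) \<Otimes>\<^sub>M PiM {..<n} (\<lambda>_. count_space UNIV) \<rightarrow>\<^sub>M N" for d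
      using assms by (intro measurable_compose[OF measurable_fst]) auto
    show "(\<lambda>\<omega>. snd (snd \<omega>)) \<in> count_space UNIV \<Otimes>\<^sub>M PiM {..<n} (\<lambda>_. \<nu>) \<Otimes>\<^sub>M PiM {..<n} (\<lambda>_. count_space (UNIV :: bool set))
        \<rightarrow>\<^sub>M count_space (PiE {..<n} (\<lambda>_. UNIV))"
      unfolding PiM[symmetric] by (rule measurable_compose[OF measurable_snd measurable_snd])
    show "countable (PiE {..<n} (\<lambda>_. UNIV :: bool set))" using fin by (rule countable_finite)
  qed
  then show ?thesis by (simp add: case_prod_beta)
qed

lemma fixed_prop_law_events:
  assumes "prob_density \<nu> f0" "prob_density \<nu> f1" "m \<le> n" "decision_rule \<nu> n K"
  shows "{(\<theta>, X, d) \<in> space (fixed_prop_law \<nu> f0 f1 n m K). P \<theta> d} \<in> sets (fixed_prop_law \<nu> f0 f1 n m K)"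
proof -
  have "(\<lambda>(\<theta>, X, d). P \<theta> d) \<in> fixed_prop_law \<nu> f0 f1 n m K \<rightarrow>\<^sub>M count_space UNIV"
    using label_decision_measurable[of P "count_space UNIV" n \<nu>]
    by (simp add: measurable_cong_sets[OF sets_fixed_prop_law[OF assms] refl])
  from predE[OF this]
  have "{\<omega> \<in> space (fixed_prop_law \<nu> f0 f1 n m K). case \<omega> of (\<theta>, X, d) \<Rightarrow> P \<theta> d} \<in> sets (fixed_prop_law \<nu> f0 f1 n m K)" .
  also have "{\<omega> \<in> space (fixed_prop_law \<nu> f0 f1 n m K). case \<omega> of (\<theta>, X, d) \<Rightarrow> P \<theta> d}
      = {(\<theta>, X, d) \<in> space (fixed_prop_law \<nu> f0 f1 n m K). P \<theta> d}" by auto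
  finally show ?thesis .
qed

text \<open>A union bound. The implication is required only on \<open>label_configs n m\<close>,
  since other label vectors have probability 0; there the number of non-nulls is known to be
  \<open>m\<close>.\<close>

lemma fixed_prop_law_prob_mono_except:
  assumes L: "prob_density \<nu> f0" "prob_density \<nu> f1" "m \<le> n" "decision_rule \<nu> n K"
    and imp: "\<And>\<theta> d. \<theta> \<in> label_configs n m \<Longrightarrow> A \<theta> d \<Longrightarrow> B \<theta> d \<or> C \<theta> d"
  shows "\<P>((\<theta>, X, d) in fixed_prop_law \<nu> f0 f1 n m K. A \<theta> d)
    \<le> \<P>((\<theta>, X, d) in fixed_prop_law \<nu> f0 f1 n m K. B \<theta> d) + \<P>((\<theta>, X, d) in fixed_prop_law \<nu> f0 f1 n m K. C \<theta> d)"
proof -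
  define M where "M = fixed_prop_law \<nu> f0 f1 n m K"
  interpret M: prob_space M unfolding M_def by (rule prob_space_fixed_prop_law[OF L])
  note ev = fixed_prop_law_events[OF L, folded M_def]
  have "(\<integral>\<^sup>+\<omega>. indicator {(\<theta>, X, d) \<in> space M. \<theta> \<notin> label_configs n m} \<omega> \<partial>M) = 0"
    unfolding M_def using ev[of "\<lambda>\<theta> _. \<theta> \<notin> label_configs n m"] finite_label_configs
    by (subst nn_integral_fixed_prop_law[OF L])
      (auto simp: M_def sets_fixed_prop_law[OF L] intro!: sum.neutral borel_measurable_indicator)
  then have null: "M.prob {(\<theta>, X, d) \<in> space M. \<theta> \<notin> label_configs n m} = 0"
    using ev[of "\<lambda>\<theta> _. \<theta> \<notin> label_configs n m"] by (simp add: M.emeasure_eq_measure)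
  have "M.prob {(\<theta>, X, d) \<in> space M. A \<theta> d}
      \<le> M.prob ({(\<theta>, X, d) \<in> space M. \<theta> \<notin> label_configs n m}
        \<union> ({(\<theta>, X, d) \<in> space M. B \<theta> d} \<union> {(\<theta>, X, d) \<in> space M. C \<theta> d}))"
    using imp by (intro M.finite_measure_mono sets.Un ev) auto
  also have "\<dots> \<le> M.prob {(\<theta>, X, d) \<in> space M. \<theta> \<notin> label_configs n m}
      + M.prob ({(\<theta>, X, d) \<in> space M. B \<theta> d} \<union> {(\<theta>, X, d) \<in> space M. C \<theta> d})"
    by (intro measure_Un_le sets.Un ev)
  also have "\<dots> \<le> 0 + (M.prob {(\<theta>, X, d) \<in> space M. B \<theta> d} + M.prob {(\<theta>, X, d) \<in> space M. C \<theta> d})"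
    unfolding null by (intro add_left_mono measure_Un_le ev)
  finally show ?thesis by (simp add: M_def)
qed

section \<open>Exponential inequalities for moment bounds\<close>

lemma exp_le_quadratic:
  fixes x :: real
  assumes "x \<le> 1"
  shows "exp x \<le> 1 + x + x\<^sup>2"
proof (cases "0 \<le> x")
  case True
  then show ?thesis using exp_bound[of x] assms by simp
next
  case False
  have pos: "0 < 1 - x" using False by simp
  have "exp x * (1 - x) \<le> exp x * exp (- x)"
    using exp_ge_add_one_self[of "- x"] by (intro mult_left_mono) auto
  also have "\<dots> = 1" by (simp add: exp_minus)
  \<comment> \<open>The right-hand side is \<open>1 - x ^ 3\<close>, which is at least 1 for
    negative \<open>x\<close>.\<close>
  also have "1 \<le> (1 + x + x\<^sup>2) * (1 - x)"
    using False by (simp add: algebra_simps power2_eq_square mult_nonpos_nonneg mult_nonneg_nonpos)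
  finally show ?thesis using pos by (simp add: mult_le_cancel_right)
qed

text \<open>As a function of \<open>s\<close> the sum equals 1 at 0 and has negative derivative
  there. With cell masses as weights, this turns a negative mean into an exponential moment below
  1.\<close>

lemma exp_sum_scale_less_1:
  fixes a b c d w1 w2 w3 w4 :: real
  assumes "w1 + w2 + w3 + w4 = 1" "w1 * a + w2 * b + w3 * c + w4 * d < 0"
  shows "\<exists>s>0. w1 * exp (s * a) + w2 * exp (s * b) + w3 * exp (s * c) + w4 * exp (s * d) < 1"
proof -
  have "((\<lambda>s. w1 * exp (s * a) + w2 * exp (s * b) + w3 * exp (s * c) + w4 * exp (s * d))
      has_real_derivative w1 * a + w2 * b + w3 * c + w4 * d) (at 0)"
    by (auto intro!: derivative_eq_intros)
  from DERIV_neg_dec_right[OF this assms(2)]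
  obtain e where e: "0 < e" "\<forall>h>0. h < e \<longrightarrow>
      w1 * exp (h * a) + w2 * exp (h * b) + w3 * exp (h * c) + w4 * exp (h * d) < 1"
    using assms(1) by auto
  then show ?thesis using e(2)[rule_format, of "e / 2"] by (intro exI[of _ "e / 2"]) simp
qed

lemma false_discoveries_eq:
  "(\<Sum>i<n. of_bool (d i) * (1 - of_bool (\<theta> i)) :: real)
    = (\<Sum>i<n. of_bool (d i)) - (\<Sum>i<n. of_bool (d i) * of_bool (\<theta> i))"
  by (simp add: right_diff_distrib sum_subtractf)

section \<open>Change of measure in the two-groups model\<close>

text \<open>\<open>f\<close>, \<open>W\<close> and \<open>Q\<close> are parameters pinned down by
  equations, so that the locale can be interpreted directly at the variables of the theorem.\<close>

locale two_groups =
  fixes \<nu> :: "'x measure" and f0 f1 f W :: "'x \<Rightarrow> real" and \<pi>0 \<pi>1 :: real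
    and Q :: "'x measure"
  assumes \<pi>0: "\<pi>0 \<in> {0<..<1}" and \<pi>1: "\<pi>1 \<in> {0<..<1}" and \<pi>_sum: "\<pi>0 + \<pi>1 = 1"
    and f0: "prob_density \<nu> f0" and f1: "prob_density \<nu> f1"
    and f_def: "f = (\<lambda>x. \<pi>0 * f0 x + \<pi>1 * f1 x)"
    and W_def: "W = (\<lambda>x. \<pi>0 * f0 x / f x)"
    and Q_def: "Q = density \<nu> (\<lambda>x. ennreal (f x))"
begin

lemma f0_measurable[measurable]: "f0 \<in> borel_measurable \<nu>"
  and f1_measurable[measurable]: "f1 \<in> borel_measurable \<nu>"
  using f0 f1 by (auto simp: prob_density_def)

lemma f_measurable[measurable]: "f \<in> borel_measurable \<nu>"
  unfolding f_def by measurable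

lemma W_measurable[measurable]: "W \<in> borel_measurable \<nu>"
  unfolding W_def by measurable

lemma sets_Q[simp, measurable_cong]: "sets Q = sets \<nu>" and space_Q[simp]: "space Q = space \<nu>"
  by (auto simp: Q_def)

lemma densities_nonneg: "x \<in> space \<nu> \<Longrightarrow> 0 \<le> f0 x" "x \<in> space \<nu> \<Longrightarrow> 0 \<le> f1 x" "x \<in> space \<nu> \<Longrightarrow> 0 \<le> f x"
  using f0 f1 \<pi>0 \<pi>1 by (auto simp: prob_density_def f_def)

text \<open>Bayes' formula without division. Where \<open>f x = 0\<close> both nonnegative
  components vanish as well, so the value 0 that division assigns to \<open>W x\<close> does no
  harm.\<close>

lemma mixture_split:
  assumes "x \<in> space \<nu>"
  shows "f x * W x = \<pi>0 * f0 x" and "f x * (1 - W x) = \<pi>1 * f1 x"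
proof -
  have "\<pi>0 * f0 x = 0 \<and> \<pi>1 * f1 x = 0" if "f x = 0"
    using that densities_nonneg[OF assms] \<pi>0 \<pi>1 by (auto simp: f_def add_nonneg_eq_0_iff)
  then show "f x * W x = \<pi>0 * f0 x" by (auto simp: W_def)
  then show "f x * (1 - W x) = \<pi>1 * f1 x" by (simp add: right_diff_distrib) (simp add: f_def)
qed

lemma W_range:
  assumes "x \<in> space \<nu>" shows "0 \<le> W x" "W x \<le> 1"
proof -
  show "0 \<le> W x" using densities_nonneg[OF assms] \<pi>0 by (simp add: W_def)
  show "W x \<le> 1"
  proof (cases "f x = 0")
    case False
    then show ?thesis
      using densities_nonneg[OF assms] \<pi>1 by (simp add: W_def divide_le_eq) (simp add: f_def)
  qed (simp add: W_def)
qed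

lemma prob_density_f: "prob_density \<nu> f"
proof -
  have "(\<integral>\<^sup>+x. ennreal (f x) \<partial>\<nu>)
      = (\<integral>\<^sup>+x. ennreal \<pi>0 * ennreal (f0 x) + ennreal \<pi>1 * ennreal (f1 x) \<partial>\<nu>)"
    using densities_nonneg \<pi>0 \<pi>1
    by (intro nn_integral_cong) (simp add: f_def ennreal_mult[symmetric] ennreal_plus[symmetric] del: ennreal_plus)
  also have "\<dots> = ennreal \<pi>0 * (\<integral>\<^sup>+x. ennreal (f0 x) \<partial>\<nu>) + ennreal \<pi>1 * (\<integral>\<^sup>+x. ennreal (f1 x) \<partial>\<nu>)"
    by (simp add: nn_integral_add nn_integral_cmult)
  also have "\<dots> = ennreal (\<pi>0 + \<pi>1)"
    using f0 f1 \<pi>0 \<pi>1 by (simp add: prob_density_def)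
  finally show ?thesis
    using densities_nonneg \<pi>_sum by (simp add: prob_density_def)
qed

sublocale Q: prob_space Q
  unfolding Q_def by (rule prob_space_density_prob_density[OF prob_density_f])

text \<open>Posterior probability of the label \<open>b\<close> given the observation
  \<open>x\<close>; \<open>prior b\<close> is its probability beforehand.\<close>

definition post :: "bool \<Rightarrow> 'x \<Rightarrow> real" where
  "post b x = (if b then 1 - W x else W x)"

definition prior :: "bool \<Rightarrow> real" where
  "prior b = (if b then \<pi>1 else \<pi>0)"

lemma post_measurable[measurable]: "post b \<in> borel_measurable \<nu>"
  unfolding post_def by measurable

lemma post_nonneg: "x \<in> space \<nu> \<Longrightarrow> 0 \<le> post b x"
  using W_range by (simp add: post_def)

lemma prior_pos: "0 < prior b"
  using \<pi>0 \<pi>1 by (simp add: prior_def)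

text \<open>By Bayes' formula each component has density posterior over prior with respect to the
  mixture \<open>Q\<close>. All label-conditional laws thereby get one common reference
  measure.\<close>

lemma density_component:
  "density \<nu> (\<lambda>x. ennreal (if b then f1 x else f0 x)) = density Q (\<lambda>x. ennreal (post b x / prior b))"
proof -
  have "density Q (\<lambda>x. ennreal (post b x / prior b))
      = density \<nu> (\<lambda>x. ennreal (f x) * ennreal (post b x / prior b))"
    unfolding Q_def by (intro density_density_eq) auto
  also have "\<dots> = density \<nu> (\<lambda>x. ennreal (if b then f1 x else f0 x))"
  proof (intro density_cong AE_I2)
    fix x assume x: "x \<in> space \<nu>"
    have "f x * (post b x / prior b) = (if b then f1 x else f0 x)"
      using mixture_split[OF x] \<pi>0 \<pi>1 by (simp add: post_def prior_def)
    then show "ennreal (f x) * ennreal (post b x / prior b) = ennreal (if b then f1 x else f0 x)"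
      using densities_nonneg[OF x] post_nonneg[OF x] prior_pos
      by (simp add: ennreal_mult[symmetric] less_imp_le)
  qed auto
  finally show ?thesis ..
qed

text \<open>The denominator is the probability of \<open>m\<close> non-nulls under independent labels; the integrand in
  the hypothesis is the exponential moment given observations and decisions.\<close>

lemma fixed_prop_chernoff:
  fixes z :: "bool \<Rightarrow> bool \<Rightarrow> real" and h :: "'x \<Rightarrow> real"
  assumes K: "decision_rule \<nu> n K" and mn: "m \<le> n"
    and h: "integrable Q h" "\<And>x. x \<in> space \<nu> \<Longrightarrow> 0 \<le> h x"
    and bound: "\<And>X. X \<in> space (PiM {..<n} (\<lambda>_. \<nu>)) \<Longrightarrow>
      (\<integral>\<^sup>+d. (\<Prod>i<n. ennreal (W (X i) * exp (z False (d i)) + (1 - W (X i)) * exp (z True (d i)))) \<partial>K X)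
        \<le> (\<Prod>i<n. ennreal (h (X i)))"
  shows "\<P>((\<theta>, X, d) in fixed_prop_law \<nu> f0 f1 n m K. 0 \<le> (\<Sum>i<n. z (\<theta> i) (d i)))
    \<le> (\<integral>x. h x \<partial>Q) ^ n / (real (n choose m) * \<pi>1 ^ m * \<pi>0 ^ (n - m))"
proof -
  define L where "L = fixed_prop_law \<nu> f0 f1 n m K"
  define S where "S = count_space (UNIV :: (nat \<Rightarrow> bool) set) \<Otimes>\<^sub>M PiM {..<n} (\<lambda>_. \<nu>) \<Otimes>\<^sub>M PiM {..<n} (\<lambda>_. count_space (UNIV :: bool set))"
  define QQ where "QQ = PiM {..<n} (\<lambda>_. Q)"
  \<comment> \<open>Probability of any single configuration with \<open>m\<close> non-nulls under
    independent labels.\<close>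
  define c where "c = \<pi>1 ^ m * \<pi>0 ^ (n - m)"
  define A where "A = {\<omega> \<in> space L. case \<omega> of (\<theta>, X, d) \<Rightarrow> 0 \<le> (\<Sum>i<n. z (\<theta> i) (d i))}"
  interpret L: prob_space L
    unfolding L_def by (rule prob_space_fixed_prop_law[OF f0 f1 mn K])
  interpret QQ: product_sigma_finite "\<lambda>_::nat. Q" ..
  have L_sets[measurable_cong]: "sets L = sets S"
    unfolding L_def S_def by (rule sets_fixed_prop_law[OF f0 f1 mn K])
  have QQ_sets[measurable_cong]: "sets QQ = sets (PiM {..<n} (\<lambda>_. \<nu>))"
    unfolding QQ_def by (intro sets_PiM_cong) auto
  have QQ_space: "space QQ = space (PiM {..<n} (\<lambda>_. \<nu>))"
    by (rule sets_eq_imp_space_eq[OF QQ_sets])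
  have K0: "K \<in> PiM {..<n} (\<lambda>_. \<nu>) \<rightarrow>\<^sub>M prob_algebra (PiM {..<n} (\<lambda>_. count_space UNIV))"
    using K by (simp add: decision_rule_def)
  note K1[measurable] = measurable_prob_algebraD[OF K0]
  have K_sets: "sets (K X) = sets (PiM {..<n} (\<lambda>_. count_space UNIV))"
    if "X \<in> space QQ" for X
    using measurable_space[OF K0] that by (auto simp: space_prob_algebra QQ_space)
  have [measurable]: "(\<lambda>\<omega>::(nat \<Rightarrow> bool) \<times> (nat \<Rightarrow> 'x) \<times> (nat \<Rightarrow> bool). fst \<omega> i) \<in> S \<rightarrow>\<^sub>M count_space UNIV" for i
    unfolding S_def by (rule measurable_compose[OF measurable_fst]) simp
  have [measurable]: "(\<lambda>\<omega>::(nat \<Rightarrow> bool) \<times> (nat \<Rightarrow> 'x) \<times> (nat \<Rightarrow> bool). snd (snd \<omega>) i) \<in> S \<rightarrow>\<^sub>M count_space UNIV" if "i \<in> {..<n}" for i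
    unfolding S_def using that by measurable
  have A[measurable]: "A \<in> sets S"
    unfolding A_def case_prod_beta L_sets[THEN sets_eq_imp_space_eq] by measurable
  have c_pos: "c > 0" using \<pi>0 \<pi>1 by (simp add: c_def)
  have X_in: "X i \<in> space \<nu>" if "X \<in> space QQ" "i < n" for X i
    using that by (auto simp: QQ_space space_PiM)
  define w where "w \<theta> X = (\<Prod>i<n. ennreal (post (\<theta> i) (X i)))" for \<theta> :: "nat \<Rightarrow> bool" and X
  define e where "e \<theta> d = (\<Prod>i<n. ennreal (exp (z (\<theta> i) (d i))))" for \<theta> d :: "nat \<Rightarrow> bool"
  have w_meas[measurable]: "w \<theta> \<in> borel_measurable QQ" for \<theta>
    unfolding w_def by measurable
  have e_meas[measurable]: "e \<theta> \<in> borel_measurable (PiM {..<n} (\<lambda>_. count_space UNIV))" for \<theta>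
    unfolding e_def by measurable
  \<comment> \<open>The exponential form of Markov's inequality: on \<open>A\<close> the exponent is
    nonnegative.\<close>
  have ind_le: "indicator A (\<theta>, X, d) \<le> e \<theta> d" for \<theta> X d
    by (auto simp: e_def A_def indicator_def prod_ennreal exp_sum[symmetric])
  have step: "ennreal c * (\<integral>\<^sup>+X. \<integral>\<^sup>+d. indicator A (\<theta>, X, d) \<partial>K X
          \<partial>PiM {..<n} (\<lambda>i. density \<nu> (\<lambda>x. ennreal (if \<theta> i then f1 x else f0 x))))
      \<le> (\<integral>\<^sup>+X. \<integral>\<^sup>+d. w \<theta> X * e \<theta> d \<partial>K X \<partial>QQ)" if \<theta>: "\<theta> \<in> label_configs n m" for \<theta>
  proof -
    define F where "F X = (\<integral>\<^sup>+d. indicator A (\<theta>, X, d) \<partial>K X)" for X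
    have [measurable]: "(\<lambda>(X, d). (\<theta>, X, d)) \<in> QQ \<Otimes>\<^sub>M PiM {..<n} (\<lambda>_. count_space UNIV) \<rightarrow>\<^sub>M S"
      unfolding S_def by measurable
    have [measurable]: "F \<in> borel_measurable QQ"
      unfolding F_def
      by (rule nn_integral_measurable_subprob_algebra2[where N="PiM {..<n} (\<lambda>_. count_space UNIV)"]) measurable
    have "PiM {..<n} (\<lambda>i. density \<nu> (\<lambda>x. ennreal (if \<theta> i then f1 x else f0 x)))
        = density QQ (\<lambda>X. \<Prod>i<n. ennreal (post (\<theta> i) (X i) / prior (\<theta> i)))"
      unfolding density_component QQ_def
    proof (rule PiM_density)
      show "prob_space (density Q (\<lambda>x. ennreal (post (\<theta> i) x / prior (\<theta> i))))" for i
        unfolding density_component[symmetric]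
        using prob_space_density_prob_density[OF f0] prob_space_density_prob_density[OF f1]
        by (cases "\<theta> i") simp_all
    qed (auto intro: Q.prob_space_axioms)
    then have "ennreal c * (\<integral>\<^sup>+X. F X \<partial>PiM {..<n} (\<lambda>i. density \<nu> (\<lambda>x. ennreal (if \<theta> i then f1 x else f0 x))))
        = ennreal c * (\<integral>\<^sup>+X. (\<Prod>i<n. ennreal (post (\<theta> i) (X i) / prior (\<theta> i))) * F X \<partial>QQ)"
      by (simp add: nn_integral_density)
    also have "\<dots> = (\<integral>\<^sup>+X. ennreal c * ((\<Prod>i<n. ennreal (post (\<theta> i) (X i) / prior (\<theta> i))) * F X) \<partial>QQ)"
      by (simp add: nn_integral_cmult)
    also have "\<dots> = (\<integral>\<^sup>+X. w \<theta> X * F X \<partial>QQ)"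
    proof (rule nn_integral_cong)
      fix X assume X: "X \<in> space QQ"
      \<comment> \<open>Written as a product of priors, \<open>c\<close> cancels the denominators of
        the component densities and leaves the posterior weights.\<close>
      have "ennreal c = (\<Prod>i<n. ennreal (prior (\<theta> i)))"
        using label_configs_prod_prior[OF \<theta>, of \<pi>1 \<pi>0] prior_pos
        by (simp add: c_def prior_def prod_ennreal less_imp_le)
      then have "ennreal c * (\<Prod>i<n. ennreal (post (\<theta> i) (X i) / prior (\<theta> i))) = w \<theta> X"
        using post_nonneg[OF X_in[OF X]] less_imp_le[OF prior_pos] less_imp_neq[OF prior_pos]
        by (auto simp: w_def prod.distrib[symmetric] ennreal_mult[symmetric] intro!: prod.cong)
      then show "ennreal c * ((\<Prod>i<n. ennreal (post (\<theta> i) (X i) / prior (\<theta> i))) * F X) = w \<theta> X * F X"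
        by (simp add: mult.assoc[symmetric])
    qed
    also have "\<dots> \<le> (\<integral>\<^sup>+X. \<integral>\<^sup>+d. w \<theta> X * e \<theta> d \<partial>K X \<partial>QQ)"
    proof (rule nn_integral_mono)
      fix X assume X: "X \<in> space QQ"
      have "w \<theta> X * F X \<le> w \<theta> X * (\<integral>\<^sup>+d. e \<theta> d \<partial>K X)"
        unfolding F_def by (intro mult_left_mono nn_integral_mono ind_le) auto
      also have "\<dots> = (\<integral>\<^sup>+d. w \<theta> X * e \<theta> d \<partial>K X)"
        using K_sets[OF X] by (intro nn_integral_cmult[symmetric]) (simp cong: measurable_cong_sets)
      finally show "w \<theta> X * F X \<le> (\<integral>\<^sup>+d. w \<theta> X * e \<theta> d \<partial>K X)" .
    qed
    finally show ?thesis unfolding F_def .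
  qed
  have "emeasure L A * (ennreal c * ennreal (real (n choose m)))
      = ennreal c * (\<Sum>\<theta>\<in>label_configs n m. \<integral>\<^sup>+X. \<integral>\<^sup>+d. indicator A (\<theta>, X, d) \<partial>K X
          \<partial>PiM {..<n} (\<lambda>i. density \<nu> (\<lambda>x. ennreal (if \<theta> i then f1 x else f0 x))))"
  proof -
    have "emeasure L A = (\<integral>\<^sup>+\<omega>. indicator A \<omega> \<partial>L)" by (simp add: L_sets)
    also have "\<dots> = (\<Sum>\<theta>\<in>label_configs n m. \<integral>\<^sup>+X. \<integral>\<^sup>+d. indicator A (\<theta>, X, d) \<partial>K X
          \<partial>PiM {..<n} (\<lambda>i. density \<nu> (\<lambda>x. ennreal (if \<theta> i then f1 x else f0 x)))) / (n choose m)"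
      (is "_ = ?T / _")
      unfolding L_def using A by (intro nn_integral_fixed_prop_law[OF f0 f1 mn K]) (simp add: S_def)
    finally have "emeasure L A = ?T / (n choose m)" .
    moreover have "?T / (n choose m) * (n choose m) = ?T"
      using mn by (simp add: ennreal_divide_times ennreal_times_divide[symmetric] ennreal_divide_self ennreal_of_nat_eq_real_of_nat)
    ultimately show ?thesis by (simp add: ac_simps ennreal_of_nat_eq_real_of_nat)
  qed
  also have "\<dots> \<le> (\<Sum>\<theta>\<in>label_configs n m. \<integral>\<^sup>+X. \<integral>\<^sup>+d. w \<theta> X * e \<theta> d \<partial>K X \<partial>QQ)"
    unfolding sum_distrib_left by (rule sum_mono) (rule step)
  \<comment> \<open>Admitting all label vectors replaces the fixed-proportion law by independent
    labels; the normalisation on the left-hand side is the price.\<close>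
  also have "\<dots> \<le> (\<Sum>\<theta>\<in>PiE {..<n} (\<lambda>_. UNIV). \<integral>\<^sup>+X. \<integral>\<^sup>+d. w \<theta> X * e \<theta> d \<partial>K X \<partial>QQ)"
    by (intro sum_mono2) (auto simp: label_configs_def intro!: finite_PiE)
  also have "\<dots> = (\<integral>\<^sup>+X. (\<Sum>\<theta>\<in>PiE {..<n} (\<lambda>_. UNIV). \<integral>\<^sup>+d. w \<theta> X * e \<theta> d \<partial>K X) \<partial>QQ)"
  proof (rule nn_integral_sum[symmetric])
    fix \<theta> :: "nat \<Rightarrow> bool"
    show "(\<lambda>X. \<integral>\<^sup>+d. w \<theta> X * e \<theta> d \<partial>K X) \<in> borel_measurable QQ"
      by (rule nn_integral_measurable_subprob_algebra2[where N="PiM {..<n} (\<lambda>_. count_space UNIV)"]) measurable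
  qed
  also have "\<dots> \<le> (\<integral>\<^sup>+X. (\<Prod>i<n. ennreal (h (X i))) \<partial>QQ)"
  proof (rule nn_integral_mono)
    fix X assume X: "X \<in> space QQ"
    have "(\<Sum>\<theta>\<in>PiE {..<n} (\<lambda>_. UNIV). \<integral>\<^sup>+d. w \<theta> X * e \<theta> d \<partial>K X)
        = (\<integral>\<^sup>+d. (\<Sum>\<theta>\<in>PiE {..<n} (\<lambda>_. UNIV). w \<theta> X * e \<theta> d) \<partial>K X)"
      using K_sets[OF X] by (intro nn_integral_sum[symmetric]) (simp cong: measurable_cong_sets)
    also have "\<dots> = (\<integral>\<^sup>+d. (\<Prod>i<n. ennreal (W (X i) * exp (z False (d i)) + (1 - W (X i)) * exp (z True (d i)))) \<partial>K X)"
    proof (rule nn_integral_cong)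
      fix d :: "nat \<Rightarrow> bool"
      have "(\<Sum>\<theta>\<in>PiE {..<n} (\<lambda>_. UNIV). w \<theta> X * e \<theta> d)
          = (\<Sum>\<theta>\<in>PiE {..<n} (\<lambda>_. UNIV). \<Prod>i<n. ennreal (post (\<theta> i) (X i)) * ennreal (exp (z (\<theta> i) (d i))))"
        by (simp add: w_def e_def prod.distrib)
      \<comment> \<open>Distributivity: given observations and decisions the labels are independent,
        so the sum over label vectors factors over the coordinates.\<close>
      also have "\<dots> = (\<Prod>i<n. \<Sum>b\<in>UNIV. ennreal (post b (X i)) * ennreal (exp (z b (d i))))"
        by (rule prod_sum_PiE[symmetric]) auto
      also have "\<dots> = (\<Prod>i<n. ennreal (W (X i) * exp (z False (d i)) + (1 - W (X i)) * exp (z True (d i))))"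
        using W_range[OF X_in[OF X]]
        by (intro prod.cong refl)
          (simp add: UNIV_bool post_def ennreal_mult ennreal_plus)
      finally show "(\<Sum>\<theta>\<in>PiE {..<n} (\<lambda>_. UNIV). w \<theta> X * e \<theta> d)
          = (\<Prod>i<n. ennreal (W (X i) * exp (z False (d i)) + (1 - W (X i)) * exp (z True (d i))))" .
    qed
    also have "\<dots> \<le> (\<Prod>i<n. ennreal (h (X i)))"
      using X by (intro bound) (simp add: QQ_space)
    finally show "(\<Sum>\<theta>\<in>PiE {..<n} (\<lambda>_. UNIV). \<integral>\<^sup>+d. w \<theta> X * e \<theta> d \<partial>K X) \<le> (\<Prod>i<n. ennreal (h (X i)))" .
  qed
  also have "\<dots> = (\<Prod>i<n. \<integral>\<^sup>+x. ennreal (h x) \<partial>Q)"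
    unfolding QQ_def using h(1) by (intro QQ.product_nn_integral_prod) auto
  also have "\<dots> = (\<Prod>i<n. ennreal (\<integral>x. h x \<partial>Q))"
    using h by (intro prod.cong refl nn_integral_eq_integral) auto
  also have "\<dots> = ennreal ((\<integral>x. h x \<partial>Q) ^ n)"
    using h by (subst prod_constant, subst ennreal_power) (auto intro!: Bochner_Integration.integral_nonneg)
  finally have "emeasure L A * (ennreal c * ennreal (real (n choose m))) \<le> ennreal ((\<integral>x. h x \<partial>Q) ^ n)" .
  moreover have "0 \<le> (\<integral>x. h x \<partial>Q)" using h by (intro Bochner_Integration.integral_nonneg) auto
  ultimately have "measure L A * (c * real (n choose m)) \<le> (\<integral>x. h x \<partial>Q) ^ n"
    using c_pos by (simp add: L.emeasure_eq_measure ennreal_mult[symmetric])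
  moreover have "0 < c * real (n choose m)" using c_pos mn by simp
  ultimately have "measure L A \<le> (\<integral>x. h x \<partial>Q) ^ n / (c * real (n choose m))"
    by (simp add: pos_le_divide_eq)
  moreover have "A = {(\<theta>, X, d) \<in> space L. 0 \<le> (\<Sum>i<n. z (\<theta> i) (d i))}" by (auto simp: A_def)
  moreover have "c * real (n choose m) = real (n choose m) * \<pi>1 ^ m * \<pi>0 ^ (n - m)" by (simp add: c_def)
  ultimately show ?thesis by (simp only: L_def)
qed

end

section \<open>The Neyman-Pearson trade-off\<close>

locale np_setup = two_groups +
  fixes p :: "real \<Rightarrow> real"
  assumes tie: "tie_prob Q W p"
begin

section \<open>The minimal null mass as a convex function of the selection probability\<close>

abbreviation "q \<equiv> quantile_W Q W"
abbreviation "\<phi> \<equiv> select_prob Q W p"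

text \<open>Joint probability of a null label and selection under independent labels: the numerator
  of \<open>a_fun\<close>.\<close>

definition R :: "real \<Rightarrow> real" where
  "R u = (\<integral>x. W x * \<phi> u x \<partial>Q)"

lemma \<phi>_measurable[measurable]: "\<phi> u \<in> borel_measurable \<nu>"
  unfolding select_prob_def by measurable

lemma \<phi>_range: "u \<in> {0..1} \<Longrightarrow> 0 \<le> \<phi> u x \<and> \<phi> u x \<le> 1"
  using tie by (auto simp: tie_prob_def select_prob_def)

lemma prob_space_\<nu>[simp]: "Q.prob (space \<nu>) = 1"
  using Q.prob_space by simp

lemma integrable_bounded:
  fixes g :: "'a \<Rightarrow> real"
  assumes "g \<in> borel_measurable \<nu>" "\<And>x. x \<in> space \<nu> \<Longrightarrow> \<bar>g x\<bar> \<le> B"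
  shows "integrable Q g"
  using assms by (intro Q.integrable_const_bound[where B=B] AE_I2) auto

lemma integrable_basic:
  "integrable Q W"
  "u \<in> {0..1} \<Longrightarrow> integrable Q (\<phi> u)"
  "u \<in> {0..1} \<Longrightarrow> integrable Q (\<lambda>x. W x * \<phi> u x)"
  "integrable Q (\<lambda>x. max 0 (t - W x))"
proof -
  show "integrable Q W" by (rule integrable_bounded[where B=1]) (use W_range in auto)
  show "integrable Q (\<phi> u)" if "u \<in> {0..1}"
    by (rule integrable_bounded[where B=1]) (use \<phi>_range[OF that] in auto)
  show "integrable Q (\<lambda>x. W x * \<phi> u x)" if "u \<in> {0..1}"
    by (rule integrable_bounded[where B=1])
      (use \<phi>_range[OF that] W_range in \<open>auto simp: abs_mult intro!: mult_le_one\<close>)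
  show "integrable Q (\<lambda>x. max 0 (t - W x))"
    by (rule integrable_bounded[where B="\<bar>t\<bar> + 1"]) (use W_range in \<open>force+\<close>)
qed

lemma integral_W: "(\<integral>x. W x \<partial>Q) = \<pi>0"
proof -
  have "(\<integral>\<^sup>+x. ennreal (W x) \<partial>Q) = (\<integral>\<^sup>+x. ennreal (f x) * ennreal (W x) \<partial>\<nu>)"
    unfolding Q_def by (intro nn_integral_density) auto
  also have "\<dots> = (\<integral>\<^sup>+x. ennreal \<pi>0 * ennreal (f0 x) \<partial>\<nu>)"
    using densities_nonneg W_range mixture_split \<pi>0
    by (intro nn_integral_cong) (simp add: ennreal_mult[symmetric])
  also have "\<dots> = ennreal \<pi>0"
    using f0 by (simp add: nn_integral_cmult prob_density_def)
  finally show ?thesis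
    using W_range \<pi>0 by (intro integral_eq_nn_integral[THEN trans]) auto
qed

lemma integral_\<phi>:
  assumes u: "u \<in> {0..1}" shows "(\<integral>x. \<phi> u x \<partial>Q) = u"
proof -
  have "(\<integral>x. \<phi> u x \<partial>Q) = (\<integral>x. indicator {x \<in> space Q. W x < q u} x + p u * indicator {x \<in> space Q. W x = q u} x \<partial>Q)"
    by (intro Bochner_Integration.integral_cong) (auto simp: select_prob_def indicator_def)
  also have "\<dots> = \<P>(x in Q. W x < q u) + p u * \<P>(x in Q. W x = q u)"
    by (subst Bochner_Integration.integral_add) (auto simp: Q.emeasure_eq_measure)
  finally show ?thesis using tie u by (simp add: tie_prob_def)
qed

text \<open>The four coefficients are the masses of the pairs (label, decision) under independent labels
  when decisions are made by the threshold rule at selection probability \<open>u\<close>.\<close>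

lemma integral_cell_masses:
  assumes u: "u \<in> {0..1}"
  shows "integrable Q (\<lambda>x. \<phi> u x * (W x * a + (1 - W x) * b) + (1 - \<phi> u x) * (W x * c + (1 - W x) * d))"
      (is "integrable Q ?g")
    and "(\<integral>x. \<phi> u x * (W x * a + (1 - W x) * b) + (1 - \<phi> u x) * (W x * c + (1 - W x) * d) \<partial>Q)
      = R u * a + (u - R u) * b + (\<pi>0 - R u) * c + (\<pi>1 - u + R u) * d"
proof -
  have eq: "?g = (\<lambda>x. (W x * \<phi> u x) * (a - b - c + d) + \<phi> u x * (b - d) + W x * (c - d) + d)"
    by (auto simp: algebra_simps)
  show "integrable Q ?g" unfolding eq using integrable_basic(1-3) u by auto
  have "(\<integral>x. ?g x \<partial>Q) = R u * (a - b - c + d) + u * (b - d) + \<pi>0 * (c - d) + d"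
    unfolding eq using integrable_basic(1-3) u
    by (simp add: R_def integral_\<phi>[OF u] integral_W)
  also have "\<dots> = R u * a + (u - R u) * b + (\<pi>0 - R u) * c + (1 - \<pi>0 - u + R u) * d"
    by (simp add: algebra_simps)
  also have "1 - \<pi>0 = \<pi>1" using \<pi>_sum by simp
  finally show "(\<integral>x. ?g x \<partial>Q) = R u * a + (u - R u) * b + (\<pi>0 - R u) * c + (\<pi>1 - u + R u) * d" .
qed

text \<open>Each mass is the integral formula at one unit vector of coefficients, where the
  integrand is nonnegative.\<close>

lemma cell_masses_nonneg:
  assumes u: "u \<in> {0..1}"
  shows "0 \<le> R u" "R u \<le> u" "R u \<le> \<pi>0" "0 \<le> \<pi>1 - u + R u"
proof -
  have nn: "0 \<le> R u * a + (u - R u) * b + (\<pi>0 - R u) * c + (\<pi>1 - u + R u) * d"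
    if "0 \<le> a" "0 \<le> b" "0 \<le> c" "0 \<le> d" for a b c d
    unfolding integral_cell_masses(2)[OF u, symmetric]
    using that \<phi>_range[OF u] W_range by (intro Bochner_Integration.integral_nonneg) auto
  show "0 \<le> R u" "R u \<le> u" "R u \<le> \<pi>0" "0 \<le> \<pi>1 - u + R u"
    using nn[of 1 0 0 0] nn[of 0 1 0 0] nn[of 0 0 1 0] nn[of 0 0 0 1] by auto
qed

lemma q_range: assumes u: "u \<in> {0..1}" shows "q u \<in> {0..1}"
proof -
  have "cdf_W Q W 1 = 1"
    unfolding cdf_W_def using W_range by (intro Q.prob_Collect_eq_1[THEN iffD2] AE_I2) auto
  then have ne: "1 \<in> {t \<in> {0..1}. u \<le> cdf_W Q W t}" using u by simp
  then have "q u \<le> 1" unfolding quantile_W_def by (rule cInf_lower) (auto intro: bdd_belowI[of _ 0])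
  moreover have "0 \<le> q u" unfolding quantile_W_def using ne by (intro cInf_greatest) auto
  ultimately show ?thesis by simp
qed

text \<open>Selection happens where \<open>W < q u\<close> and possibly on the tie, where
  \<open>W - q u\<close> vanishes; so \<open>(W - q u) * \<phi> u\<close> equals
  \<open>- max 0 (q u - W)\<close> pointwise, whatever the tie-breaking.\<close>

lemma R_conjugate:
  assumes u: "u \<in> {0..1}"
  shows "R u - q u * u = - (\<integral>x. max 0 (q u - W x) \<partial>Q)"
proof -
  have "R u - q u * u = (\<integral>x. W x * \<phi> u x - q u * \<phi> u x \<partial>Q)"
    using integrable_basic u by (simp add: R_def integral_\<phi>)
  also have "\<dots> = (\<integral>x. - max 0 (q u - W x) \<partial>Q)"
    by (intro Bochner_Integration.integral_cong) (auto simp: select_prob_def)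
  finally show ?thesis by simp
qed

text \<open>The Neyman-Pearson argument: \<open>\<phi> u\<close> minimises the integral of
  \<open>(W - q u) * \<phi>\<close> over selection functions, and \<open>\<phi> r\<close> is a
  competitor.\<close>

lemma R_supporting_line:
  assumes u: "u \<in> {0..1}" and r: "r \<in> {0..1}"
  shows "R u + q u * (r - u) \<le> R r"
proof -
  have "- (\<integral>x. max 0 (q u - W x) \<partial>Q) = (\<integral>x. - max 0 (q u - W x) \<partial>Q)" by simp
  also have "\<dots> \<le> (\<integral>x. W x * \<phi> r x - q u * \<phi> r x \<partial>Q)"
  proof (intro integral_mono)
    fix x assume x: "x \<in> space Q"
    have "(q u - W x) * \<phi> r x \<le> max 0 (q u - W x) * 1"
      using \<phi>_range[OF r] by (intro mult_mono) auto
    then show "- max 0 (q u - W x) \<le> W x * \<phi> r x - q u * \<phi> r x" by (simp add: algebra_simps)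
  qed (use integrable_basic r in auto)
  also have "\<dots> = R r - q u * r"
    using integrable_basic r by (simp add: R_def integral_\<phi>)
  finally show ?thesis using R_conjugate[OF u] by (simp add: algebra_simps)
qed

text \<open>The line supporting \<open>R\<close> at the smaller point has nonnegative slope.\<close>

lemma R_mono: assumes "u \<in> {0..1}" "r \<in> {0..1}" "r \<le> u" shows "R r \<le> R u"
proof -
  have "0 \<le> q r * (u - r)" using q_range[of r] assms by (intro mult_nonneg_nonneg) auto
  then show ?thesis using R_supporting_line[of r u] assms by linarith
qed

text \<open>The line supporting \<open>R\<close> at the larger point has slope at most 1.\<close>

lemma R_lipschitz: assumes "u \<in> {0..1}" "r \<in> {0..1}" "r \<le> u" shows "R u - R r \<le> u - r"
proof -
  have "q u * (u - r) \<le> 1 * (u - r)" using q_range[of u] assms by (intro mult_right_mono) auto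
  then show ?thesis using R_supporting_line[of u r] assms by (simp add: algebra_simps)
qed

lemma R_continuous: "continuous_on {0..1} R"
proof -
  have "1-lipschitz_on {0..1} R"
  proof (rule lipschitz_onI)
    fix x y :: real assume "x \<in> {0..1}" "y \<in> {0..1}"
    then show "dist (R x) (R y) \<le> 1 * dist x y"
      using R_mono[of x y] R_mono[of y x] R_lipschitz[of x y] R_lipschitz[of y x]
      by (cases "x \<le> y") (auto simp: dist_real_def)
  qed simp
  then show ?thesis by (rule lipschitz_on_continuous_on)
qed

lemma R_0: "R 0 = 0" and R_1: "R 1 = \<pi>0"
  using cell_masses_nonneg[of 0] cell_masses_nonneg[of 1] \<pi>_sum by auto

section \<open>Conditional expectations under the selection law\<close>

lemma sets_select_law: "sets (select_law Q W p u) = sets (Q \<Otimes>\<^sub>M count_space UNIV)"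
  and nn_integral_select_law:
    "u \<in> {0..1} \<Longrightarrow> g \<in> borel_measurable (Q \<Otimes>\<^sub>M count_space UNIV) \<Longrightarrow>
     (\<integral>\<^sup>+y. g y \<partial>select_law Q W p u)
       = (\<integral>\<^sup>+x. g (x, True) * ennreal (\<phi> u x) + g (x, False) * ennreal (1 - \<phi> u x) \<partial>Q)"
proof -
  define N where "N = Q \<Otimes>\<^sub>M count_space (UNIV :: bool set)"
  define k where "k x = measure_pmf (bernoulli_pmf (\<phi> u x)) \<bind> (\<lambda>s. return N (x, s))" for x
  have law: "select_law Q W p u = Q \<bind> k"
    by (simp add: select_law_def k_def[abs_def] N_def)
  have ret: "(\<lambda>s. return N (x, s)) \<in> measure_pmf P \<rightarrow>\<^sub>M subprob_algebra N" if "x \<in> space Q" for x P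
    using that by (auto simp: space_subprob_algebra N_def space_pair_measure
      intro!: prob_space_imp_subprob_space prob_space_return)
  have k_sets: "sets (k x) = sets N" for x
    unfolding k_def by (intro sets_bind) auto
  show "sets (select_law Q W p u) = sets (Q \<Otimes>\<^sub>M count_space UNIV)"
    unfolding law N_def[symmetric] by (intro sets_bind k_sets Q.not_empty)
  assume u: "u \<in> {0..1}" and "g \<in> borel_measurable (Q \<Otimes>\<^sub>M count_space UNIV)"
  then have g: "g \<in> borel_measurable N" by (simp add: N_def)
  \<comment> \<open>Averaging over the coin gives two terms. The formula is stated for all
    measurable \<open>g\<close>, since indicators of sets are inserted below to obtain measurability
    of \<open>k\<close>.\<close>
  have k_int: "(\<integral>\<^sup>+y. g y \<partial>k x) = g (x, True) * ennreal (\<phi> u x) + g (x, False) * ennreal (1 - \<phi> u x)"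
    if x: "x \<in> space Q" and g: "g \<in> borel_measurable N" for x and g
  proof -
    have "(\<integral>\<^sup>+y. g y \<partial>k x) = (\<integral>\<^sup>+s. \<integral>\<^sup>+y. g y \<partial>return N (x, s) \<partial>measure_pmf (bernoulli_pmf (\<phi> u x)))"
      unfolding k_def by (rule nn_integral_bind[OF g ret[OF x]])
    also have "\<dots> = (\<integral>\<^sup>+s. g (x, s) \<partial>measure_pmf (bernoulli_pmf (\<phi> u x)))"
      using x by (intro nn_integral_cong nn_integral_return g) (simp add: N_def space_pair_measure)
    finally show ?thesis using \<phi>_range[OF u] by simp
  qed
  have "k \<in> Q \<rightarrow>\<^sub>M subprob_algebra N"
  proof (rule measurable_subprob_algebra)
    fix x assume x: "x \<in> space Q"
    show "subprob_space (k x)"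
      unfolding k_def by (rule subprob_space_bind[OF measure_pmf.subprob_space_axioms ret[OF x]])
    show "sets (k x) = sets N" by (rule k_sets)
  next
    fix A assume A[measurable]: "A \<in> sets N"
    have 1: "emeasure (k x) A = indicator A (x, True) * ennreal (\<phi> u x) + indicator A (x, False) * ennreal (1 - \<phi> u x)"
      if "x \<in> space Q" for x
      using k_int[OF that, of "indicator A"] A by (simp add: k_sets)
    have [measurable]: "(\<lambda>x. (x, s)) \<in> Q \<rightarrow>\<^sub>M N" for s unfolding N_def by measurable
    have 2: "(\<lambda>x. indicator A (x, True) * ennreal (\<phi> u x) + indicator A (x, False) * ennreal (1 - \<phi> u x)) \<in> borel_measurable Q"
      by measurable
    show "(\<lambda>x. emeasure (k x) A) \<in> borel_measurable Q"
      by (rule measurable_cong[THEN iffD2, OF 1 2])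
  qed
  then have "(\<integral>\<^sup>+y. g y \<partial>select_law Q W p u) = (\<integral>\<^sup>+x. \<integral>\<^sup>+y. g y \<partial>k x \<partial>Q)"
    unfolding law by (rule nn_integral_bind[OF g])
  also note nn_integral_cong[OF k_int[OF _ g]]
  finally show "(\<integral>\<^sup>+y. g y \<partial>select_law Q W p u)
       = (\<integral>\<^sup>+x. g (x, True) * ennreal (\<phi> u x) + g (x, False) * ennreal (1 - \<phi> u x) \<partial>Q)"
    by simp
qed

text \<open>\<open>w x\<close> is the conditional probability of \<open>s = b\<close> given
  \<open>x\<close>, so conditioning on that event becomes a weighted mean. With \<open>b\<close>
  true this serves \<open>a_fun\<close>, with \<open>b\<close> false \<open>b_fun\<close>.\<close>

lemma cond_expect_select_law:
  fixes Y :: "'a \<Rightarrow> real"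
  assumes u: "u \<in> {0..1}" and Y[measurable]: "Y \<in> borel_measurable \<nu>"
    and Y01: "\<And>x. x \<in> space \<nu> \<Longrightarrow> 0 \<le> Y x \<and> Y x \<le> 1"
    and A: "A = (\<lambda>(x, s). s = b)" and w: "w = (\<lambda>x. if b then \<phi> u x else 1 - \<phi> u x)"
    and pos: "0 < (\<integral>x. w x \<partial>Q)"
  shows "cond_expect (select_law Q W p u) (\<lambda>(x, s). Y x) A = (\<integral>x. Y x * w x \<partial>Q) / (\<integral>x. w x \<partial>Q)"
proof -
  define N where "N = select_law Q W p u"
  have N_sets[measurable_cong]: "sets N = sets (Q \<Otimes>\<^sub>M count_space UNIV)"
    unfolding N_def by (rule sets_select_law)
  define E where "E = {y \<in> space N. A y}"
  have E[measurable]: "E \<in> sets N"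
    unfolding E_def A case_prod_beta by measurable
  then have E'[measurable]: "E \<in> sets (Q \<Otimes>\<^sub>M count_space UNIV)" by (simp add: N_sets)
  have E_iff: "(x, s) \<in> E \<longleftrightarrow> s = b" if "x \<in> space \<nu>" for x s
    using that N_sets[THEN sets_eq_imp_space_eq] by (auto simp: E_def A space_pair_measure)
  have w01: "0 \<le> w x" "w x \<le> 1" for x using \<phi>_range[OF u, of x] by (auto simp: w)
  have [measurable]: "w \<in> borel_measurable \<nu>" unfolding w by measurable
  have int: "integrable Q w" "integrable Q (\<lambda>x. Y x * w x)"
    using w01 Y01 by (auto intro!: integrable_bounded[where B=1] mult_le_one simp: abs_mult)
  have sel: "(\<integral>\<^sup>+y. g y * indicator E y \<partial>N) = (\<integral>\<^sup>+x. g (x, b) * ennreal (w x) \<partial>Q)"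
    if [measurable]: "g \<in> borel_measurable (Q \<Otimes>\<^sub>M count_space UNIV)" for g
    unfolding N_def
    by (subst nn_integral_select_law[OF u]) (auto intro!: nn_integral_cong simp: E_iff w indicator_def)
  have "emeasure N E = (\<integral>\<^sup>+y. 1 * indicator E y \<partial>N)" by simp
  also have "\<dots> = ennreal (\<integral>x. w x \<partial>Q)"
    using int w01 by (subst sel) (auto intro!: nn_integral_eq_integral)
  finally have E_mass: "emeasure N E = ennreal (\<integral>x. w x \<partial>Q)" .
  have "(\<integral>\<^sup>+y. ennreal (Y (fst y)) \<partial>uniform_measure N E) = (\<integral>\<^sup>+y. ennreal (Y (fst y)) * indicator E y \<partial>N) / emeasure N E"
    by (intro nn_integral_uniform_measure) measurable
  also have "(\<integral>\<^sup>+y. ennreal (Y (fst y)) * indicator E y \<partial>N) = (\<integral>\<^sup>+x. ennreal (Y x * w x) \<partial>Q)"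
    using Y01 w01 by (subst sel) (auto intro!: nn_integral_cong simp: ennreal_mult)
  also have "\<dots> = ennreal (\<integral>x. Y x * w x \<partial>Q)"
    using int Y01 w01 by (intro nn_integral_eq_integral) auto
  also have "ennreal (\<integral>x. Y x * w x \<partial>Q) / emeasure N E = ennreal ((\<integral>x. Y x * w x \<partial>Q) / (\<integral>x. w x \<partial>Q))"
    unfolding E_mass using pos Y01 w01
    by (intro divide_ennreal Bochner_Integration.integral_nonneg) auto
  finally have *: "(\<integral>\<^sup>+y. ennreal (Y (fst y)) \<partial>uniform_measure N E) = ennreal ((\<integral>x. Y x * w x \<partial>Q) / (\<integral>x. w x \<partial>Q))" .
  have "(\<integral>y. Y (fst y) \<partial>uniform_measure N E) = enn2real (\<integral>\<^sup>+y. ennreal (Y (fst y)) \<partial>uniform_measure N E)"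
    using Y01 N_sets[THEN sets_eq_imp_space_eq]
    by (intro integral_eq_nn_integral AE_I2) (auto simp: space_pair_measure)
  also have "\<dots> = (\<integral>x. Y x * w x \<partial>Q) / (\<integral>x. w x \<partial>Q)"
    unfolding * using pos Y01 w01
    by (intro enn2real_ennreal divide_nonneg_nonneg Bochner_Integration.integral_nonneg) auto
  finally show ?thesis
    unfolding cond_expect_def N_def[symmetric] E_def[symmetric] case_prod_beta .
qed

lemma a_fun_eq: assumes u: "0 < u" "u \<le> 1" shows "a_fun Q W p u = R u / u"
  using u W_range integral_\<phi>[of u] unfolding a_fun_def
  by (subst cond_expect_select_law[where b=True, OF _ _ _ _ refl]) (auto simp: R_def)

lemma b_fun_eq: assumes u: "0 \<le> u" "u < 1" shows "b_fun Q W p u = (\<pi>1 - u + R u) / (1 - u)"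
proof -
  have u': "u \<in> {0..1}" using u by simp
  have mass: "(\<integral>x. 1 - \<phi> u x \<partial>Q) = 1 - u"
    using integrable_basic(2)[OF u'] by (simp add: integral_\<phi>[OF u'])
  \<comment> \<open>The numerator is the mass of unselected non-nulls, the fourth cell.\<close>
  have "(\<integral>x. (1 - W x) * (1 - \<phi> u x) \<partial>Q) = \<pi>1 - u + R u"
    using integral_cell_masses(2)[OF u', of 0 0 0 1] by (simp add: ac_simps)
  moreover have "b_fun Q W p u = (\<integral>x. (1 - W x) * (1 - \<phi> u x) \<partial>Q) / (\<integral>x. 1 - \<phi> u x \<partial>Q)"
    using u u' W_range mass unfolding b_fun_def
    by (subst cond_expect_select_law[where b=False, OF _ _ _ _ refl]) auto
  ultimately show ?thesis by (simp add: mass)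
qed

lemma b_fun_nonneg: "u \<in> {0..1} \<Longrightarrow> 0 \<le> b_fun Q W p u"
  using cell_masses_nonneg[of u] by (cases "u = 1") (auto simp: b_fun_eq, simp add: b_fun_def)

section \<open>The largest feasible selection probability and the value
  \<open>b_star\<close>\<close>

context
  fixes \<alpha> :: real
  assumes \<alpha>: "\<alpha> \<in> {0..1}"
begin

abbreviation "u\<^sub>\<alpha> \<equiv> u_star Q W p \<alpha>"

text \<open>Clearing the denominator of \<open>a_fun\<close> also covers \<open>u = 0\<close>, where
  the convention that \<open>a_fun\<close> is 0 agrees with \<open>R 0 = 0\<close>; the new
  constraint is continuous in \<open>u\<close>.\<close>

lemma feasible_eq: "{u \<in> {0..1}. a_fun Q W p u \<le> \<alpha>} = {u \<in> {0..1}. R u \<le> \<alpha> * u}"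
proof -
  have "a_fun Q W p u \<le> \<alpha> \<longleftrightarrow> R u \<le> \<alpha> * u" if "u \<in> {0..1}" for u
  proof (cases "u = 0")
    case True
    then show ?thesis using \<alpha> by (simp add: a_fun_def R_0)
  next
    case False
    then show ?thesis using that by (simp add: a_fun_eq divide_le_eq)
  qed
  then show ?thesis by blast
qed

text \<open>The supremum is attained: by continuity of \<open>R\<close> the feasible set is closed,
  and it contains 0.\<close>

lemma u_star_feasible: "u\<^sub>\<alpha> \<in> {u \<in> {0..1}. R u \<le> \<alpha> * u}"
  unfolding u_star_def feasible_eq
proof (rule closed_contains_Sup)
  show "closed {u \<in> {0..1}. R u \<le> \<alpha> * u}"
    by (rule continuous_on_closed_Collect_le[OF R_continuous]) (auto intro: continuous_intros)
  show "{u \<in> {0..1}. R u \<le> \<alpha> * u} \<noteq> {}"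
    using R_0 by (auto intro!: exI[of _ 0])
qed auto

lemma u_star_upper: "u \<in> {0..1} \<Longrightarrow> R u \<le> \<alpha> * u \<Longrightarrow> u \<le> u\<^sub>\<alpha>"
  unfolding u_star_def feasible_eq by (rule cSup_upper) auto

lemma b_star_nonneg: "0 \<le> b_star Q W p \<alpha>"
  unfolding b_star_def feasible_eq using u_star_feasible b_fun_nonneg by (intro cInf_greatest) auto

text \<open>Among feasible \<open>u\<close> the value of \<open>b_fun\<close> is smallest at the
  largest one. Stated without division, the bound also holds when that one is 1, where both sides
  are 0.\<close>

lemma b_star_bound:
  assumes \<beta>: "b_star Q W p \<alpha> \<le> \<beta>"
  shows "\<pi>1 - u\<^sub>\<alpha> + R u\<^sub>\<alpha> \<le> \<beta> * (1 - u\<^sub>\<alpha>)"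
proof (cases "u\<^sub>\<alpha> = 1")
  case True
  then show ?thesis using R_1 \<pi>_sum by simp
next
  case False
  define v where "v = u\<^sub>\<alpha>"
  have v: "v \<in> {0..1}" "v < 1" using u_star_feasible False by (auto simp: v_def)
  have "(\<pi>1 - v + R v) / (1 - v) \<le> b_fun Q W p u" if u: "u \<in> {0..1}" "R u \<le> \<alpha> * u" for u
  proof -
    have uv: "u \<le> v" using u_star_upper u by (simp add: v_def)
    have s1: "R v + q v * (u - v) \<le> R u" and s2: "R v + q v * (1 - v) \<le> \<pi>0"
      using R_supporting_line[of v u] R_supporting_line[of v 1] u v by (auto simp: R_1)
    \<comment> \<open>The supporting line at \<open>v\<close>, evaluated at \<open>u\<close> and at
      1, is combined with weights \<open>1 - v\<close> and \<open>v - u\<close>; the terms with the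
      slope \<open>q v\<close> cancel.\<close>
    have "(v - u) * (R v + q v * (1 - v)) \<le> (v - u) * \<pi>0"
      using s2 uv by (intro mult_left_mono) auto
    moreover have "(1 - v) * (R v + q v * (u - v)) \<le> (1 - v) * R u"
      using s1 v by (intro mult_left_mono) auto
    moreover have \<pi>1_eq: "\<pi>1 = 1 - \<pi>0" using \<pi>_sum by simp
    ultimately have "(\<pi>1 - v + R v) * (1 - u) \<le> (\<pi>1 - u + R u) * (1 - v)"
      unfolding \<pi>1_eq by (simp add: algebra_simps)
    then show ?thesis
      using u v uv by (simp add: b_fun_eq frac_le_eq divide_le_eq le_divide_eq pos_divide_le_eq)
  qed
  then have "(\<pi>1 - v + R v) / (1 - v) \<le> b_star Q W p \<alpha>"
    unfolding b_star_def feasible_eq using u_star_feasible by (intro cInf_greatest) auto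
  then have "(\<pi>1 - v + R v) / (1 - v) \<le> \<beta>" using \<beta> by simp
  then show ?thesis using v by (simp add: v_def[symmetric] pos_divide_le_eq)
qed

text \<open>The hypothesis concerns only \<open>u\<close> above \<open>u_star\<close>, where the
  constraint is violated strictly; this is the room the converse needs. Letting \<open>u\<close>
  decrease to \<open>u_star\<close> then bounds \<open>b_fun\<close> there.\<close>

lemma b_star_leI:
  assumes \<beta>: "0 \<le> \<beta>"
    and le: "\<And>u. u\<^sub>\<alpha> < u \<Longrightarrow> u < 1 \<Longrightarrow> \<pi>1 - u + R u \<le> \<beta> * (1 - u)"
  shows "b_star Q W p \<alpha> \<le> \<beta>"
proof -
  define v where "v = u\<^sub>\<alpha>"
  have v: "v \<in> {0..1}" "R v \<le> \<alpha> * v" using u_star_feasible by (auto simp: v_def)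
  have "b_star Q W p \<alpha> \<le> b_fun Q W p v"
    unfolding b_star_def feasible_eq using v b_fun_nonneg
    by (intro cInf_lower) (auto intro!: bdd_belowI[of _ 0])
  also have "b_fun Q W p v \<le> \<beta>"
  proof (cases "v = 1")
    case True
    then show ?thesis using \<beta> by (simp add: b_fun_def)
  next
    case False
    with v have v1: "v < 1" by simp
    have "\<pi>1 - v + R v \<le> \<beta> * (1 - u) + (u - v)" if "v < u" "u < 1" for u
      using le[of u] that v R_mono[of u v] by (simp add: v_def)
    then have "\<forall>\<^sub>F u in at_right v. \<pi>1 - v + R v \<le> \<beta> * (1 - u) + (u - v)"
      using v1 unfolding eventually_at_right_field by blast
    moreover have "((\<lambda>u. \<beta> * (1 - u) + (u - v)) \<longlongrightarrow> \<beta> * (1 - v) + (v - v)) (at_right v)"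
      by (intro tendsto_intros)
    ultimately have "\<pi>1 - v + R v \<le> \<beta> * (1 - v) + (v - v)"
      by (intro tendsto_lowerbound) auto
    then show ?thesis using v1 v by (simp add: b_fun_eq pos_divide_le_eq)
  qed
  finally show ?thesis .
qed

end

end

section \<open>Achievability and converse\<close>

context np_setup
begin

section \<open>Achievability by the threshold rule\<close>

lemma np_rule_decision_rule:
  assumes "u_star Q W p \<alpha> \<in> {0..1}" shows "decision_rule \<nu> n (np_rule Q W p \<alpha> n)"
  unfolding decision_rule_def np_rule_def
proof (rule PiM_bernoulli_kernel)
  show "(\<lambda>X. \<phi> (u_star Q W p \<alpha>) (X i)) \<in> borel_measurable (PiM {..<n} (\<lambda>_. \<nu>))" if "i \<in> {..<n}" for i
    using that by measurable
qed (use \<phi>_range[OF assms] in auto)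

text \<open>The coins of the rule are independent given the observations, so the conditional moment
  factors exactly, and the Chernoff bound applies with \<open>h\<close> averaged over the coin. Its
  mean is a combination of the four cell masses.\<close>

lemma np_rule_chernoff:
  fixes z :: "bool \<Rightarrow> bool \<Rightarrow> real" and \<alpha> :: real
  defines "u \<equiv> u_star Q W p \<alpha>"
  assumes u: "u_star Q W p \<alpha> \<in> {0..1}" and mn: "m \<le> n"
  shows "\<P>((\<theta>, X, d) in fixed_prop_law \<nu> f0 f1 n m (np_rule Q W p \<alpha> n). 0 \<le> (\<Sum>i<n. z (\<theta> i) (d i)))
    \<le> (R u * exp (z False True) + (u - R u) * exp (z True True)
        + (\<pi>0 - R u) * exp (z False False) + (\<pi>1 - u + R u) * exp (z True False)) ^ n
      / (real (n choose m) * \<pi>1 ^ m * \<pi>0 ^ (n - m))"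
proof -
  have u01: "u \<in> {0..1}" using u by (simp add: u_def)
  define l where "l x s = W x * exp (z False s) + (1 - W x) * exp (z True s)" for x s
  define h where "h x = \<phi> u x * l x True + (1 - \<phi> u x) * l x False" for x
  have l_nonneg: "0 \<le> l x s" if "x \<in> space \<nu>" for x s
    using W_range[OF that] by (simp add: l_def)
  have h_int: "integrable Q h" and h_eq: "(\<integral>x. h x \<partial>Q) = R u * exp (z False True) + (u - R u) * exp (z True True)
        + (\<pi>0 - R u) * exp (z False False) + (\<pi>1 - u + R u) * exp (z True False)"
    using integral_cell_masses[OF u01, of "exp (z False True)" "exp (z True True)" "exp (z False False)" "exp (z True False)"]
    by (simp_all add: h_def[abs_def] l_def)
  show ?thesis
    unfolding h_eq[symmetric]
  proof (rule fixed_prop_chernoff[OF np_rule_decision_rule[OF u] mn h_int])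
    show "0 \<le> h x" if "x \<in> space \<nu>" for x
      using l_nonneg[OF that] \<phi>_range[OF u01] by (simp add: h_def)
    fix X assume X: "X \<in> space (PiM {..<n} (\<lambda>_. \<nu>))"
    interpret product_sigma_finite "\<lambda>i. measure_pmf (bernoulli_pmf (\<phi> u (X i)))" ..
    have "(\<integral>\<^sup>+d. (\<Prod>i<n. ennreal (l (X i) (d i))) \<partial>np_rule Q W p \<alpha> n X)
        = (\<Prod>i<n. \<integral>\<^sup>+s. ennreal (l (X i) s) \<partial>measure_pmf (bernoulli_pmf (\<phi> u (X i))))"
      unfolding np_rule_def u_def[symmetric] by (rule product_nn_integral_prod) auto
    also have "\<dots> = (\<Prod>i<n. ennreal (h (X i)))"
    proof (intro prod.cong refl)
      fix i assume "i \<in> {..<n}"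
      then have "X i \<in> space \<nu>" using X by (auto simp: space_PiM)
      then show "(\<integral>\<^sup>+s. ennreal (l (X i) s) \<partial>measure_pmf (bernoulli_pmf (\<phi> u (X i)))) = ennreal (h (X i))"
        using \<phi>_range[OF u01, of "X i"] l_nonneg
        by (simp add: h_def ennreal_mult[symmetric] ennreal_plus[symmetric] mult.commute del: ennreal_plus)
    qed
    finally show "(\<integral>\<^sup>+d. (\<Prod>i<n. ennreal (W (X i) * exp (z False (d i)) + (1 - W (X i)) * exp (z True (d i))))
        \<partial>np_rule Q W p \<alpha> n X) \<le> (\<Prod>i<n. ennreal (h (X i)))"
      by (simp add: l_def)
  qed
qed

text \<open>The weights \<open>z n\<close> may change with \<open>n\<close>, as the degenerate
  selection probabilities 0 and 1 require; the moments only have to stay below one common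
  \<open>\<rho> < 1\<close>.\<close>

lemma np_rule_event_tendsto_1:
  fixes z :: "nat \<Rightarrow> bool \<Rightarrow> bool \<Rightarrow> real" and \<alpha> :: real
  defines "u \<equiv> u_star Q W p \<alpha>"
  assumes u: "u_star Q W p \<alpha> \<in> {0..1}"
    and m: "\<forall>n\<ge>1. m n \<le> n" "(\<lambda>n. real (m n) / real n) \<longlonglongrightarrow> \<pi>1"
    and good: "\<And>n \<theta> d. 1 \<le> n \<Longrightarrow> \<theta> \<in> label_configs n (m n) \<Longrightarrow> \<not> G n \<theta> d \<Longrightarrow> 0 \<le> (\<Sum>i<n. z n (\<theta> i) (d i))"
    and \<rho>: "\<And>n. R u * exp (z n False True) + (u - R u) * exp (z n True True)
        + (\<pi>0 - R u) * exp (z n False False) + (\<pi>1 - u + R u) * exp (z n True False) \<le> \<rho>" "\<rho> < 1"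
  shows "(\<lambda>n. \<P>((\<theta>, X, d) in fixed_prop_law \<nu> f0 f1 n (m n) (np_rule Q W p \<alpha> n). G n \<theta> d)) \<longlonglongrightarrow> 1"
proof -
  have u01: "u \<in> {0..1}" using u by (simp add: u_def)
  define mgf where "mgf n = R u * exp (z n False True) + (u - R u) * exp (z n True True)
        + (\<pi>0 - R u) * exp (z n False False) + (\<pi>1 - u + R u) * exp (z n True False)" for n
  have mgf: "0 \<le> mgf n" "mgf n \<le> \<rho>" for n
    using \<rho>(1) cell_masses_nonneg[OF u01] by (auto simp: mgf_def)
  define D where "D n = real (n choose m n) * \<pi>1 ^ m n * \<pi>0 ^ (n - m n)" for n
  have lim: "(\<lambda>n. \<rho> ^ n / D n) \<longlonglongrightarrow> 0"
    unfolding D_def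
    using exponential_beats_type_probability[of \<pi>0 \<pi>1 \<rho> m] \<pi>0 \<pi>1 \<pi>_sum m \<rho>(2) mgf order_trans[OF mgf] by auto
  define P where "P n = \<P>((\<theta>, X, d) in fixed_prop_law \<nu> f0 f1 n (m n) (np_rule Q W p \<alpha> n). G n \<theta> d)" for n
  have bounds: "1 - \<rho> ^ n / D n \<le> P n \<and> P n \<le> 1" if n: "1 \<le> n" for n
  proof -
    have mn: "m n \<le> n" using m(1) n by simp
    note L = f0 f1 mn np_rule_decision_rule[OF u, of n]
    interpret M: prob_space "fixed_prop_law \<nu> f0 f1 n (m n) (np_rule Q W p \<alpha> n)"
      by (rule prob_space_fixed_prop_law[OF L])
    have "1 = \<P>((\<theta>, X, d) in fixed_prop_law \<nu> f0 f1 n (m n) (np_rule Q W p \<alpha> n). True)"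
      using M.prob_space by simp
    also have "\<dots> \<le> P n + \<P>((\<theta>, X, d) in fixed_prop_law \<nu> f0 f1 n (m n) (np_rule Q W p \<alpha> n). 0 \<le> (\<Sum>i<n. z n (\<theta> i) (d i)))"
      unfolding P_def by (rule fixed_prop_law_prob_mono_except[OF L]) (use good[OF n] in blast)
    also have "\<dots> \<le> P n + mgf n ^ n / D n"
      unfolding mgf_def D_def u_def by (intro add_left_mono np_rule_chernoff[OF u mn])
    also have "\<dots> \<le> P n + \<rho> ^ n / D n"
      using mgf \<pi>0 \<pi>1 by (intro add_left_mono divide_right_mono power_mono) (auto simp: D_def)
    finally show ?thesis unfolding P_def by simp
  qed
  have "(\<lambda>n. 1 - \<rho> ^ n / D n) \<longlonglongrightarrow> 1 - 0" by (intro tendsto_intros lim)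
  then have lower: "(\<lambda>n. 1 - \<rho> ^ n / D n) \<longlonglongrightarrow> 1" by simp
  have "\<forall>\<^sub>F n in sequentially. 1 - \<rho> ^ n / D n \<le> P n"
    using eventually_ge_at_top[of 1] by eventually_elim (use bounds in blast)
  moreover have "\<forall>\<^sub>F n in sequentially. P n \<le> 1"
    using eventually_ge_at_top[of 1] by eventually_elim (use bounds in blast)
  ultimately have "P \<longlonglongrightarrow> 1"
    by (rule tendsto_sandwich[OF _ _ lower tendsto_const])
  then show ?thesis unfolding P_def[abs_def] .
qed

text \<open>If the threshold rule selects nothing (or everything) almost surely, its FDP (or FNP) is 0
  except on a null event; that event is charged with a weight growing with \<open>n\<close>, so that a single
  exceptional index already makes the exponent nonnegative.\<close>

lemma exceptional_index_sum:
  fixes e :: "nat \<Rightarrow> bool"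
  assumes "j < n" "e j"
  shows "0 \<le> (\<Sum>i<n. if e i then real n else -1)"
proof -
  have "(\<Sum>i<n. if i = j then real n else -1) \<le> (\<Sum>i<n. if e i then real n else -1)"
    using assms by (intro sum_mono) auto
  moreover have "(\<Sum>i<n. if i = j then real n else -1) = real n + (\<Sum>i\<in>{..<n} - {j}. -1)"
    using assms by (subst sum.remove[of _ j]) auto
  ultimately show ?thesis using assms by simp
qed

context
  fixes \<alpha> :: real and n1 :: "nat \<Rightarrow> nat"
  assumes \<alpha>: "\<alpha> \<in> {0..1}"
    and n1: "\<forall>n\<ge>1. n1 n \<le> n" "(\<lambda>n. real (n1 n) / real n) \<longlonglongrightarrow> \<pi>1"
begin

lemma u_star_range: "u_star Q W p \<alpha> \<in> {0..1}" and R_u_star: "R (u_star Q W p \<alpha>) \<le> \<alpha> * u_star Q W p \<alpha>"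
  using u_star_feasible[OF \<alpha>] by auto

lemma np_rule_FDP:
  assumes \<epsilon>: "0 < \<epsilon>"
  shows "(\<lambda>n. \<P>((\<theta>, X, d) in fixed_prop_law \<nu> f0 f1 n (n1 n) (np_rule Q W p \<alpha> n). FDP n \<theta> d \<le> \<alpha> + \<epsilon>)) \<longlonglongrightarrow> 1"
proof (cases "u_star Q W p \<alpha> = 0")
  case True
  show ?thesis
  \<comment> \<open>The cells with a rejection have mass 0 here, so the weight \<open>n\<close> on
    them costs nothing and the moment is \<open>exp (-1)\<close>.\<close>
  proof (rule np_rule_event_tendsto_1[OF u_star_range n1, where z="\<lambda>n \<theta> d. if d then real n else -1" and \<rho>="exp (-1)"])
    fix n :: nat and \<theta> d :: "nat \<Rightarrow> bool"
    assume bad: "\<not> FDP n \<theta> d \<le> \<alpha> + \<epsilon>"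
    have "\<exists>j<n. d j"
    proof (rule ccontr)
      assume "\<not> (\<exists>j<n. d j)"
      then have "FDP n \<theta> d = 0" by (simp add: FDP_def)
      then show False using bad \<alpha> \<epsilon> by simp
    qed
    then show "0 \<le> (\<Sum>i<n. if d i then real n else -1)" using exceptional_index_sum by blast
  qed (use True R_0 \<pi>_sum in \<open>simp_all add: distrib_right[symmetric]\<close>)
next
  case False
  define u where "u = u_star Q W p \<alpha>"
  define \<gamma> where "\<gamma> = \<alpha> + \<epsilon>"
  have u: "0 < u" "R u \<le> \<alpha> * u" using False u_star_range R_u_star by (auto simp: u_def)
  \<comment> \<open>The drift is \<open>R u - \<gamma> * u\<close>, hence at most
    \<open>- \<epsilon> * u\<close>.\<close>
  have "R u * (1 - \<gamma>) + (u - R u) * - \<gamma> + (\<pi>0 - R u) * 0 + (\<pi>1 - u + R u) * 0 < 0"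
    using u mult_pos_pos[OF \<epsilon> u(1)] by (simp add: \<gamma>_def algebra_simps)
  from exp_sum_scale_less_1[OF _ this] \<pi>_sum
  obtain s where s: "0 < s" "R u * exp (s * (1 - \<gamma>)) + (u - R u) * exp (s * - \<gamma>)
      + (\<pi>0 - R u) * exp (s * 0) + (\<pi>1 - u + R u) * exp (s * 0) < 1" by auto
  show ?thesis
  proof (rule np_rule_event_tendsto_1[OF u_star_range n1,
        where z="\<lambda>n \<theta> d. s * (of_bool d * (1 - of_bool \<theta>) - \<gamma> * of_bool d)", OF _ _ s(2)])
    fix n :: nat and \<theta> d :: "nat \<Rightarrow> bool"
    assume bad: "\<not> FDP n \<theta> d \<le> \<alpha> + \<epsilon>"
    have "\<gamma> * (\<Sum>i<n. of_bool (d i)) \<le> \<gamma> * max 1 (\<Sum>i<n. of_bool (d i))"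
      using \<alpha> \<epsilon> by (intro mult_left_mono) (auto simp: \<gamma>_def)
    also have "\<dots> \<le> (\<Sum>i<n. of_bool (d i) * (1 - of_bool (\<theta> i)))"
      using bad by (simp add: FDP_def \<gamma>_def not_le pos_less_divide_eq)
    finally have "0 \<le> s * ((\<Sum>i<n. of_bool (d i) * (1 - of_bool (\<theta> i))) - \<gamma> * (\<Sum>i<n. of_bool (d i)))"
      using s by simp
    then show "0 \<le> (\<Sum>i<n. s * (of_bool (d i) * (1 - of_bool (\<theta> i)) - \<gamma> * of_bool (d i)))"
      by (simp add: sum_distrib_left[symmetric] sum_subtractf)
  qed (simp_all add: u_def)
qed

text \<open>Mirror image of the bound for \<open>FDP\<close>, with unselected in place of selected
  indices and the drift controlled by \<open>b_star_bound\<close>.\<close>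

lemma np_rule_FNP:
  assumes \<epsilon>: "0 < \<epsilon>" and \<beta>: "b_star Q W p \<alpha> \<le> \<beta>" "0 \<le> \<beta>"
  shows "(\<lambda>n. \<P>((\<theta>, X, d) in fixed_prop_law \<nu> f0 f1 n (n1 n) (np_rule Q W p \<alpha> n). FNP n \<theta> d \<le> \<beta> + \<epsilon>)) \<longlonglongrightarrow> 1"
proof (cases "u_star Q W p \<alpha> = 1")
  case True
  show ?thesis
  proof (rule np_rule_event_tendsto_1[OF u_star_range n1, where z="\<lambda>n \<theta> d. if \<not> d then real n else -1" and \<rho>="exp (-1)"])
    fix n :: nat and \<theta> d :: "nat \<Rightarrow> bool"
    assume bad: "\<not> FNP n \<theta> d \<le> \<beta> + \<epsilon>"
    have "\<exists>j<n. \<not> d j"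
    proof (rule ccontr)
      assume "\<not> (\<exists>j<n. \<not> d j)"
      then have "FNP n \<theta> d = 0" by (simp add: FNP_def)
      then show False using bad \<beta> \<epsilon> by simp
    qed
    then show "0 \<le> (\<Sum>i<n. if \<not> d i then real n else -1)"
      using exceptional_index_sum[of _ n "\<lambda>i. \<not> d i"] by blast
  next
    \<comment> \<open>With \<open>R 1 = \<pi>0\<close> both cells of unselected indices have mass 0,
      so the weight \<open>n\<close> on them is free.\<close>
    have "\<pi>1 - 1 + \<pi>0 = 0" using \<pi>_sum by simp
    moreover have "\<pi>0 * exp (- 1) + (1 - \<pi>0) * exp (- 1) = exp (- 1 :: real)" by (simp add: algebra_simps)
    ultimately show "R (u_star Q W p \<alpha>) * exp (if \<not> True then real n else -1)
        + (u_star Q W p \<alpha> - R (u_star Q W p \<alpha>)) * exp (if \<not> True then real n else -1)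
        + (\<pi>0 - R (u_star Q W p \<alpha>)) * exp (if \<not> False then real n else -1)
        + (\<pi>1 - u_star Q W p \<alpha> + R (u_star Q W p \<alpha>)) * exp (if \<not> False then real n else -1) \<le> exp (-1)" for n
      unfolding True R_1 by simp
  qed simp
next
  case False
  define u where "u = u_star Q W p \<alpha>"
  define \<gamma> where "\<gamma> = \<beta> + \<epsilon>"
  have u: "u < 1" "\<pi>1 - u + R u \<le> \<beta> * (1 - u)"
    using False u_star_range b_star_bound[OF \<alpha> \<beta>(1)] by (auto simp: u_def)
  have "R u * 0 + (u - R u) * 0 + (\<pi>0 - R u) * - \<gamma> + (\<pi>1 - u + R u) * (1 - \<gamma>)
      = (\<pi>1 - u + R u) - \<gamma> * (\<pi>0 + \<pi>1 - u)" by (simp add: algebra_simps)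
  also have "\<dots> \<le> \<beta> * (1 - u) - \<gamma> * (1 - u)" using u \<pi>_sum by simp
  also have "\<dots> = - \<epsilon> * (1 - u)" by (simp add: \<gamma>_def algebra_simps)
  also have "\<dots> < 0" using u \<epsilon> by simp
  finally have "R u * 0 + (u - R u) * 0 + (\<pi>0 - R u) * - \<gamma> + (\<pi>1 - u + R u) * (1 - \<gamma>) < 0" .
  from exp_sum_scale_less_1[OF _ this] \<pi>_sum
  obtain s where s: "0 < s" "R u * exp (s * 0) + (u - R u) * exp (s * 0)
      + (\<pi>0 - R u) * exp (s * - \<gamma>) + (\<pi>1 - u + R u) * exp (s * (1 - \<gamma>)) < 1" by auto
  show ?thesis
  proof (rule np_rule_event_tendsto_1[OF u_star_range n1,
        where z="\<lambda>n \<theta> d. s * ((1 - of_bool d) * of_bool \<theta> - \<gamma> * (1 - of_bool d))", OF _ _ s(2)])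
    fix n :: nat and \<theta> d :: "nat \<Rightarrow> bool"
    assume bad: "\<not> FNP n \<theta> d \<le> \<beta> + \<epsilon>"
    have "\<gamma> * (\<Sum>i<n. 1 - of_bool (d i)) \<le> \<gamma> * max 1 (\<Sum>i<n. 1 - of_bool (d i))"
      using \<beta> \<epsilon> by (intro mult_left_mono) (auto simp: \<gamma>_def)
    also have "\<dots> \<le> (\<Sum>i<n. (1 - of_bool (d i)) * of_bool (\<theta> i))"
      using bad by (simp add: FNP_def \<gamma>_def not_le pos_less_divide_eq)
    finally have "0 \<le> s * ((\<Sum>i<n. (1 - of_bool (d i)) * of_bool (\<theta> i)) - \<gamma> * (\<Sum>i<n. 1 - of_bool (d i)))"
      using s by (intro mult_nonneg_nonneg) auto
    also have "\<dots> = (\<Sum>i<n. s * ((1 - of_bool (d i)) * of_bool (\<theta> i) - \<gamma> * (1 - of_bool (d i))))"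
      by (simp only: sum_distrib_left[symmetric] sum_subtractf)
    finally show "0 \<le> (\<Sum>i<n. s * ((1 - of_bool (d i)) * of_bool (\<theta> i) - \<gamma> * (1 - of_bool (d i))))" .
  qed (simp_all add: u_def)
qed

section \<open>Converse for arbitrary decision rules\<close>

text \<open>When \<open>t\<close> is a quantile, \<open>t r - \<integral>max 0 (t - W)\<close> as a function of the rejection fraction \<open>r\<close> is a
  supporting line of \<open>R\<close>.\<close>

lemma false_discovery_lower_tail:
  fixes t \<epsilon> :: real
  defines "c \<equiv> (\<integral>x. max 0 (t - W x) \<partial>Q)"
  assumes \<delta>: "\<And>n. 1 \<le> n \<Longrightarrow> decision_rule \<nu> n (\<delta> n)" and t: "t \<in> {0..1}" and \<epsilon>: "0 < \<epsilon>" "\<epsilon> \<le> 1"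
  shows "(\<lambda>n. \<P>((\<theta>, X, d) in fixed_prop_law \<nu> f0 f1 n (n1 n) (\<delta> n).
    (\<Sum>i<n. of_bool (d i) * (1 - of_bool (\<theta> i))) \<le> t * (\<Sum>i<n. of_bool (d i)) - real n * (c + \<epsilon>))) \<longlonglongrightarrow> 0"
proof -
  \<comment> \<open>This choice makes the final exponent \<open>s * \<epsilon> - s * s\<close>
    positive, and \<open>s \<le> 1\<close> admits the quadratic bound of \<open>exp\<close>.\<close>
  define s where "s = \<epsilon> / 2"
  have s: "0 < s" "s \<le> 1" using \<epsilon> by (auto simp: s_def)
  define z where "z \<theta> d = s * (of_bool d * (t - (1 - of_bool \<theta>)) - (c + \<epsilon>))" for \<theta> d
  define h where "h x = exp (- s * (c + \<epsilon>)) * (1 + s * max 0 (t - W x) + s\<^sup>2)" for x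
  define \<rho> where "\<rho> = (\<integral>x. h x \<partial>Q)"
  have h_nonneg: "0 \<le> h x" for x using s by (simp add: h_def)
  have h_int: "integrable Q h" unfolding h_def using integrable_basic(4) by simp
  have "\<rho> = exp (- s * (c + \<epsilon>)) * (1 + s * c + s\<^sup>2)"
    unfolding \<rho>_def h_def c_def using integrable_basic(4) by simp
  also have "\<dots> \<le> exp (- s * (c + \<epsilon>)) * exp (s * c + s\<^sup>2)"
    using exp_ge_add_one_self[of "s * c + s\<^sup>2"] by (intro mult_left_mono) (simp_all add: add.assoc)
  also have "\<dots> = exp (- (s * \<epsilon> - s\<^sup>2))" by (simp add: exp_add[symmetric] algebra_simps)
  also have "\<dots> < 1" using \<epsilon> by (simp add: s_def power2_eq_square)
  finally have \<rho>: "\<rho> < 1" .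
  have \<rho>0: "0 \<le> \<rho>" unfolding \<rho>_def using h_nonneg by (intro Bochner_Integration.integral_nonneg) auto
  \<comment> \<open>The bound covers both values of the decision: not rejecting gains nothing,
    rejecting gains \<open>t - W x\<close> on average over the label. So no kernel gains more than
    \<open>max 0 (t - W x)\<close>.\<close>
  have pointwise: "W x * exp (z False d) + (1 - W x) * exp (z True d) \<le> h x" if x: "x \<in> space \<nu>" for x d
  proof -
    have quad: "exp (s * y) \<le> 1 + s * y + s\<^sup>2" if "\<bar>y\<bar> \<le> 1" for y
    proof -
      have "s * y \<le> s * 1" using s that by (intro mult_left_mono) auto
      also have "\<dots> \<le> 1" using s by simp
      finally have "s * y \<le> 1" .
      then have "exp (s * y) \<le> 1 + s * y + (s * y)\<^sup>2" by (rule exp_le_quadratic)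
      also have "(s * y)\<^sup>2 \<le> s\<^sup>2 * 1"
        unfolding power_mult_distrib using that by (intro mult_left_mono) (auto simp: abs_square_le_1)
      finally show ?thesis by simp
    qed
    have "W x * exp (s * (of_bool d * (t - 1))) + (1 - W x) * exp (s * (of_bool d * t)) \<le> 1 + s * max 0 (t - W x) + s\<^sup>2"
    proof (cases d)
      case True
      have "W x * exp (s * (t - 1)) + (1 - W x) * exp (s * t)
          \<le> W x * (1 + s * (t - 1) + s\<^sup>2) + (1 - W x) * (1 + s * t + s\<^sup>2)"
        using W_range[OF x] t quad by (intro add_mono mult_left_mono) auto
      also have "\<dots> = 1 + s * (t - W x) + s\<^sup>2" by (simp add: algebra_simps)
      also have "\<dots> \<le> 1 + s * max 0 (t - W x) + s\<^sup>2" using s by (intro add_mono mult_left_mono) auto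
      finally show ?thesis using True by simp
    qed (use s in simp)
    then have "exp (- s * (c + \<epsilon>)) * (W x * exp (s * (of_bool d * (t - 1))) + (1 - W x) * exp (s * (of_bool d * t))) \<le> h x"
      unfolding h_def by (intro mult_left_mono) auto
    also have "exp (- s * (c + \<epsilon>)) * (W x * exp (s * (of_bool d * (t - 1))) + (1 - W x) * exp (s * (of_bool d * t)))
        = W x * exp (z False d) + (1 - W x) * exp (z True d)"
    proof -
      have e: "exp (s * (y - (c + \<epsilon>))) = exp (- s * (c + \<epsilon>)) * exp (s * y)" for y
        by (simp add: exp_add[symmetric] algebra_simps)
      have "z False d = s * (of_bool d * (t - 1) - (c + \<epsilon>))" "z True d = s * (of_bool d * t - (c + \<epsilon>))"
        by (simp_all add: z_def)
      then show ?thesis by (simp only: e distrib_left mult.left_commute)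
    qed
    finally show ?thesis .
  qed
  define P where "P n = \<P>((\<theta>, X, d) in fixed_prop_law \<nu> f0 f1 n (n1 n) (\<delta> n).
    (\<Sum>i<n. of_bool (d i) * (1 - of_bool (\<theta> i))) \<le> t * (\<Sum>i<n. of_bool (d i)) - real n * (c + \<epsilon>))" for n
  have bound: "P n \<le> \<rho> ^ n / (real (n choose n1 n) * \<pi>1 ^ n1 n * \<pi>0 ^ (n - n1 n))" if n: "1 \<le> n" for n
  proof -
    have mn: "n1 n \<le> n" using n1(1) n by simp
    have iff: "(\<Sum>i<n. of_bool (d i) * (1 - of_bool (\<theta> i))) \<le> t * (\<Sum>i<n. of_bool (d i)) - real n * (c + \<epsilon>)
        \<longleftrightarrow> 0 \<le> (\<Sum>i<n. z (\<theta> i) (d i))" for \<theta> d :: "nat \<Rightarrow> bool"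
    proof -
      have sum_z: "(\<Sum>i<n. z (\<theta> i) (d i)) = s * (t * (\<Sum>i<n. of_bool (d i)) - (\<Sum>i<n. of_bool (d i) * (1 - of_bool (\<theta> i))) - real n * (c + \<epsilon>))"
        unfolding z_def sum_distrib_left[symmetric] right_diff_distrib[of "of_bool _" t]
        by (simp add: sum_subtractf sum_distrib_left mult.commute)
      have pos: "0 \<le> s * y \<longleftrightarrow> 0 \<le> y" for y using s by (simp add: zero_le_mult_iff)
      show ?thesis unfolding sum_z pos by linarith
    qed
    show ?thesis
      unfolding P_def iff \<rho>_def
    proof (rule fixed_prop_chernoff[OF \<delta>[OF n] mn h_int h_nonneg])
      fix X assume X: "X \<in> space (PiM {..<n} (\<lambda>_. \<nu>))"
      have K: "prob_space (\<delta> n X)"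
        using \<delta>[OF n] X by (auto simp: decision_rule_def space_prob_algebra dest: measurable_space)
      have Xi: "X i \<in> space \<nu>" if "i < n" for i using X that by (auto simp: space_PiM)
      have "(\<integral>\<^sup>+d. (\<Prod>i<n. ennreal (W (X i) * exp (z False (d i)) + (1 - W (X i)) * exp (z True (d i)))) \<partial>\<delta> n X)
          \<le> (\<integral>\<^sup>+d. (\<Prod>i<n. ennreal (h (X i))) \<partial>\<delta> n X)"
        using pointwise Xi by (intro nn_integral_mono prod_mono_ennreal ennreal_leI) auto
      \<comment> \<open>The bound does not involve \<open>d\<close>, so integrating over the kernel
        only contributes its total mass 1.\<close>
      also have "\<dots> = (\<Prod>i<n. ennreal (h (X i)))"
        using prob_space.emeasure_space_1[OF K] by simp
      finally show "(\<integral>\<^sup>+d. (\<Prod>i<n. ennreal (W (X i) * exp (z False (d i)) + (1 - W (X i)) * exp (z True (d i)))) \<partial>\<delta> n X)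
          \<le> (\<Prod>i<n. ennreal (h (X i)))" .
    qed
  qed
  have upper: "(\<lambda>n. \<rho> ^ n / (real (n choose n1 n) * \<pi>1 ^ n1 n * \<pi>0 ^ (n - n1 n))) \<longlonglongrightarrow> 0"
    using exponential_beats_type_probability[of \<pi>0 \<pi>1 \<rho> n1] \<pi>0 \<pi>1 \<pi>_sum n1 \<rho> \<rho>0 by auto
  have "\<forall>\<^sub>F n in sequentially. 0 \<le> P n" by (simp add: P_def)
  moreover have "\<forall>\<^sub>F n in sequentially. P n \<le> \<rho> ^ n / (real (n choose n1 n) * \<pi>1 ^ n1 n * \<pi>0 ^ (n - n1 n))"
    using eventually_ge_at_top[of 1] by eventually_elim (use bound in blast)
  ultimately have "P \<longlonglongrightarrow> 0"
    by (rule tendsto_sandwich[OF _ _ tendsto_const upper])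
  then show ?thesis unfolding P_def[abs_def] .
qed

text \<open>A deterministic statement about one outcome, in terms of the fraction \<open>r\<close>
  of rejections and \<open>v\<close> of false discoveries. Of the loss
  \<open>2 * \<epsilon>\<close>, one \<open>\<epsilon>\<close> comes from the tail bound and one
  from the deviation of \<open>m / n\<close> from \<open>\<pi>1\<close>.\<close>

lemma FNP_lower_bound:
  fixes u \<epsilon> :: real and \<theta> d :: "nat \<Rightarrow> bool"
  assumes u: "u_star Q W p \<alpha> < u" "u < 1" and \<epsilon>: "\<epsilon> \<le> R u - \<alpha> * u"
    and n: "1 \<le> n" "\<bar>real m / real n - \<pi>1\<bar> \<le> \<epsilon>" and \<theta>: "\<theta> \<in> label_configs n m"
    and FDP: "FDP n \<theta> d \<le> \<alpha>"
    and tail: "q u * (\<Sum>i<n. of_bool (d i)) - real n * ((\<integral>x. max 0 (q u - W x) \<partial>Q) + \<epsilon>)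
      < (\<Sum>i<n. of_bool (d i) * (1 - of_bool (\<theta> i)))"
  shows "(\<pi>1 - u + R u - 2 * \<epsilon>) / (1 - u) \<le> FNP n \<theta> d"
proof -
  define t where "t = q u"
  define r where "r = (\<Sum>i<n. of_bool (d i)) / real n"
  define v where "v = (\<Sum>i<n. of_bool (d i) * (1 - of_bool (\<theta> i))) / real n"
  have u01: "u \<in> {0..1}" "0 < u" using u u_star_range by auto
  have sums: "(\<Sum>i<n. of_bool (d i)) = real n * r" "(\<Sum>i<n. of_bool (d i) * (1 - of_bool (\<theta> i))) = real n * v"
    using n by (simp_all add: r_def v_def)
  have r01: "0 \<le> r"
    unfolding r_def by (intro divide_nonneg_nonneg sum_nonneg) auto
  \<comment> \<open>The count is kept as a natural number, so that integrality makes
    \<open>max 1\<close> inactive: in \<open>FDP\<close> once there is a rejection, in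
    \<open>FNP\<close> once there is a non-rejection.\<close>
  define N where "N = (\<Sum>i<n. of_bool (d i) :: nat)"
  have N: "real N = real n * r" using n by (simp add: N_def r_def)
  have v_upper: "v \<le> \<alpha> * r"
  proof (cases "N = 0")
    case True
    then have "\<forall>i<n. \<not> d i" by (auto simp: N_def)
    then show ?thesis by (simp add: v_def r_def)
  next
    case False
    then have "1 \<le> real n * r" using N by linarith
    then have "FDP n \<theta> d = (real n * v) / (real n * r)" and "0 < r"
      unfolding FDP_def sums using n by (auto simp: zero_less_mult_iff max_def dest: less_le_trans[OF zero_less_one])
    then show ?thesis using FDP n by (simp add: pos_divide_le_eq)
  qed
  have v_lower: "R u + t * (r - u) - \<epsilon> < v"
  proof -
    have "real n * (t * r - ((\<integral>x. max 0 (t - W x) \<partial>Q) + \<epsilon>)) < real n * v"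
      using tail unfolding sums t_def by (simp add: algebra_simps)
    then have "t * r - ((\<integral>x. max 0 (t - W x) \<partial>Q) + \<epsilon>) < v" using n by simp
    then show ?thesis using R_conjugate[OF u01(1)] by (simp add: t_def algebra_simps)
  qed
  have Ru: "\<alpha> * u < R u"
    using u_star_upper[OF \<alpha> u01(1)] u by (meson not_less)
  \<comment> \<open>The supporting line at \<open>u\<close> passes at or below the origin, so its
    slope is at least \<open>R u / u\<close>, which exceeds \<open>\<alpha>\<close> beyond
    \<open>u_star\<close>.\<close>
  have "R u \<le> t * u"
    using R_supporting_line[OF u01(1), of 0] by (simp add: R_0 t_def)
  then have "\<alpha> * u < t * u" using Ru by simp
  then have t\<alpha>: "\<alpha> < t" using u01 by simp
  \<comment> \<open>From \<open>u\<close> on, the line less \<open>\<epsilon>\<close> is at least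
    \<open>\<alpha> * r\<close>, by the bound on \<open>\<epsilon>\<close>; this contradicts
    \<open>FDP n \<theta> d \<le> \<alpha>\<close>.\<close>
  have ru: "r < u"
  proof (rule ccontr)
    assume "\<not> r < u"
    then have "\<alpha> * (r - u) \<le> t * (r - u)" using t\<alpha> by (intro mult_right_mono) auto
    then show False using v_lower v_upper \<epsilon> by (simp add: algebra_simps)
  qed
  have t1: "t * (1 - u) \<le> \<pi>0 - R u"
    using R_supporting_line[OF u01(1), of 1] by (simp add: R_1 t_def)
  \<comment> \<open>Fraction of missed non-nulls: all non-nulls less the true discoveries
    \<open>r - v\<close>.\<close>
  define x where "x = real m / real n - r + v"
  have "FNP n \<theta> d = (real n * x) / max 1 (real n * (1 - r))"
  proof -
    have "(\<Sum>i<n. (1 - of_bool (d i)) * of_bool (\<theta> i)) = (\<Sum>i<n. of_bool (\<theta> i)) - (\<Sum>i<n. of_bool (d i) * of_bool (\<theta> i) :: real)"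
      by (simp add: left_diff_distrib sum_subtractf)
    also have "\<dots> = real m - (real n * r - real n * v)"
      using false_discoveries_eq[of d \<theta> n] label_configs_sum[OF \<theta>] sums by simp
    also have "\<dots> = real n * x" using n by (simp add: x_def algebra_simps)
    finally have "(\<Sum>i<n. (1 - of_bool (d i)) * of_bool (\<theta> i)) = real n * x" .
    moreover have "(\<Sum>i<n. 1 - of_bool (d i) :: real) = real n * (1 - r)"
      using sums by (simp add: sum_subtractf algebra_simps)
    ultimately show ?thesis unfolding FNP_def by simp
  qed
  also have "max 1 (real n * (1 - r)) = real n * (1 - r)"
  proof -
    have "real N < real n"
      unfolding N using ru u n by (simp add: mult_less_cancel_left)
    then have "N + 1 \<le> n" by simp
    then have "real (N + 1) \<le> real n" by (rule of_nat_mono)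
    then show ?thesis by (simp add: N algebra_simps)
  qed
  also have "real n * x / (real n * (1 - r)) = x / (1 - r)" using n by simp
  finally have FNP: "FNP n \<theta> d = x / (1 - r)" .
  define k where "k = \<pi>1 - u + R u - 2 * \<epsilon>"
  have \<epsilon>0: "0 \<le> \<epsilon>" using n by linarith
  \<comment> \<open>By the line evaluated at 1. It shows that rejecting less than the fraction
    \<open>u\<close> cannot push the bound on \<open>FNP\<close> below
    \<open>k / (1 - u)\<close>.\<close>
  have "k \<le> (1 - t) * (1 - u)" using t1 \<pi>_sum \<epsilon>0 by (simp add: k_def algebra_simps)
  then have "(u - r) * k \<le> (u - r) * ((1 - t) * (1 - u))" using ru by (intro mult_left_mono) auto
  then have "k * (1 - r) \<le> (k + (u - r) * (1 - t)) * (1 - u)" by (simp add: algebra_simps)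
  also have "\<dots> \<le> x * (1 - u)"
    using v_lower n u by (intro mult_right_mono) (auto simp: k_def x_def abs_le_iff algebra_simps)
  finally show ?thesis
    unfolding FNP k_def[symmetric] using ru u by (simp add: pos_divide_le_eq pos_le_divide_eq)
qed

text \<open>The crude upper bound is enough for integrability.\<close>

lemma FNP_range: "0 \<le> FNP n \<theta> d" "FNP n \<theta> d \<le> real n"
proof -
  have nonneg: "0 \<le> (\<Sum>i<n. (1 - of_bool (d i)) * of_bool (\<theta> i) :: real)" by (intro sum_nonneg) auto
  then show "0 \<le> FNP n \<theta> d" by (simp add: FNP_def)
  have "(\<Sum>i<n. (1 - of_bool (d i)) * of_bool (\<theta> i)) \<le> (\<Sum>i<n. 1 :: real)"
    by (intro sum_mono) auto
  moreover have "FNP n \<theta> d \<le> (\<Sum>i<n. (1 - of_bool (d i)) * of_bool (\<theta> i)) / 1"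
    unfolding FNP_def using nonneg by (intro divide_left_mono) auto
  ultimately show "FNP n \<theta> d \<le> real n" by simp
qed

text \<open>Markov's inequality. With \<open>k = 0\<close> it also yields nonnegativity of the
  FNR.\<close>

lemma FNR_lower_bound:
  assumes "m \<le> n" "decision_rule \<nu> n K" and k: "0 \<le> k" and A: "\<And>\<theta> d. A \<theta> d \<Longrightarrow> k \<le> FNP n \<theta> d"
  shows "k * \<P>((\<theta>, X, d) in fixed_prop_law \<nu> f0 f1 n m K. A \<theta> d) \<le> FNR n (fixed_prop_law \<nu> f0 f1 n m K)"
proof -
  note L = f0 f1 assms(1,2)
  define M where "M = fixed_prop_law \<nu> f0 f1 n m K"
  interpret M: prob_space M unfolding M_def by (rule prob_space_fixed_prop_law[OF L])
  note ev = fixed_prop_law_events[OF L, folded M_def]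
  have meas: "(\<lambda>(\<theta>, X, d). FNP n \<theta> d) \<in> borel_measurable M"
    using label_decision_measurable[of "FNP n" borel n \<nu>]
    by (simp add: M_def measurable_cong_sets[OF sets_fixed_prop_law[OF L] refl])
  have int: "integrable M (\<lambda>(\<theta>, X, d). FNP n \<theta> d)"
    by (intro M.integrable_const_bound[where B="real n"] meas AE_I2) (auto simp: FNP_range)
  define E where "E = {(\<theta>, X, d) \<in> space M. A \<theta> d}"
  have E: "E \<in> sets M" unfolding E_def by (rule ev)
  have "k * M.prob E = (\<integral>\<omega>. k * indicator E \<omega> \<partial>M)"
    using E by simp
  also have "\<dots> \<le> (\<integral>\<omega>. (case \<omega> of (\<theta>, X, d) \<Rightarrow> FNP n \<theta> d) \<partial>M)"
  proof (rule integral_mono[OF _ int])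
    show "integrable M (\<lambda>\<omega>. k * indicator E \<omega> :: real)"
      using E by (intro integrable_mult_right integrable_real_indicator) (auto simp: M.emeasure_eq_measure)
    show "k * indicator E \<omega> \<le> (case \<omega> of (\<theta>, X, d) \<Rightarrow> FNP n \<theta> d)" for \<omega>
      using A k FNP_range by (auto simp: E_def indicator_def)
  qed
  finally show ?thesis by (simp only: FNR_def M_def E_def)
qed

text \<open>For each \<open>u\<close> strictly between \<open>u_star\<close> and 1, with probability
  tending to 1 both \<open>FDP \<le> \<alpha>\<close> and the bound on false discoveries hold; then
  \<open>FNP\<close> is nearly at least the value of \<open>b_fun\<close> at \<open>u\<close>, and
  Markov's inequality transfers this to the FNR.\<close>

lemma converse_bound:
  assumes \<delta>: "\<And>n. 1 \<le> n \<Longrightarrow> decision_rule \<nu> n (\<delta> n)"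
    and FDP: "(\<lambda>n. \<P>((\<theta>, X, d) in fixed_prop_law \<nu> f0 f1 n (n1 n) (\<delta> n). FDP n \<theta> d \<le> \<alpha>)) \<longlonglongrightarrow> 1"
    and FNR: "\<And>n. 1 \<le> n \<Longrightarrow> FNR n (fixed_prop_law \<nu> f0 f1 n (n1 n) (\<delta> n)) \<le> \<beta>"
  shows "b_star Q W p \<alpha> \<le> \<beta>"
proof (rule b_star_leI[OF \<alpha>])
  show \<beta>0: "0 \<le> \<beta>"
    using FNR_lower_bound[of "n1 1" 1 "\<delta> 1" 0 "\<lambda>_ _. False"] n1(1) \<delta>[of 1] FNR[of 1] by simp
  fix u assume u: "u_star Q W p \<alpha> < u" "u < 1"
  have u01: "u \<in> {0..1}" using u u_star_range by auto
  have Ru: "\<alpha> * u < R u" using u_star_upper[OF \<alpha> u01] u by (meson not_less)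
  have main: "(\<pi>1 - u + R u - 2 * \<epsilon>) / (1 - u) \<le> \<beta>" if \<epsilon>: "0 < \<epsilon>" "\<epsilon> \<le> 1" "\<epsilon> \<le> R u - \<alpha> * u" for \<epsilon>
  \<comment> \<open>Markov's inequality needs a nonnegative level; a negative one is below
    \<open>\<beta>\<close> anyway.\<close>
  proof (cases "0 \<le> (\<pi>1 - u + R u - 2 * \<epsilon>) / (1 - u)")
    case False
    then show ?thesis using \<beta>0 by linarith
  next
    case True
    define k where "k = (\<pi>1 - u + R u - 2 * \<epsilon>) / (1 - u)"
    define bad where "bad n \<theta> d \<longleftrightarrow> (\<Sum>i<n. of_bool (d i) * (1 - of_bool (\<theta> i)))
      \<le> q u * (\<Sum>i<n. of_bool (d i)) - real n * ((\<integral>x. max 0 (q u - W x) \<partial>Q) + \<epsilon>)" for n and \<theta> d :: "nat \<Rightarrow> bool"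
    define PF where "PF n = \<P>((\<theta>, X, d) in fixed_prop_law \<nu> f0 f1 n (n1 n) (\<delta> n). FDP n \<theta> d \<le> \<alpha>)" for n
    define PB where "PB n = \<P>((\<theta>, X, d) in fixed_prop_law \<nu> f0 f1 n (n1 n) (\<delta> n). bad n \<theta> d)" for n
    have PB: "PB \<longlonglongrightarrow> 0"
      unfolding PB_def[abs_def] bad_def using \<delta> q_range[OF u01] \<epsilon>(1,2) by (rule false_discovery_lower_tail)
    have "\<forall>\<^sub>F n in sequentially. dist (real (n1 n) / real n) \<pi>1 < \<epsilon>"
      using tendstoD[OF n1(2) \<epsilon>(1)] .
    then have "\<forall>\<^sub>F n in sequentially. k * (PF n - PB n) \<le> \<beta>"
      using eventually_ge_at_top[of 1]
    proof eventually_elim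
      case (elim n)
      then have mn: "n1 n \<le> n" using n1(1) by simp
      have "PF n \<le> \<P>((\<theta>, X, d) in fixed_prop_law \<nu> f0 f1 n (n1 n) (\<delta> n). k \<le> FNP n \<theta> d) + PB n"
        unfolding PF_def PB_def
      proof (rule fixed_prop_law_prob_mono_except[OF f0 f1 mn \<delta>])
        show "1 \<le> n" by (rule elim)
        fix \<theta> d assume "\<theta> \<in> label_configs n (n1 n)" "FDP n \<theta> d \<le> \<alpha>"
        then show "k \<le> FNP n \<theta> d \<or> bad n \<theta> d"
          using FNP_lower_bound[OF u \<epsilon>(3), of n "n1 n" \<theta> d] elim
          by (auto simp: k_def bad_def dist_real_def not_le)
      qed
      then have "k * (PF n - PB n) \<le> k * \<P>((\<theta>, X, d) in fixed_prop_law \<nu> f0 f1 n (n1 n) (\<delta> n). k \<le> FNP n \<theta> d)"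
        using True by (intro mult_left_mono) (auto simp: k_def)
      also have "\<dots> \<le> FNR n (fixed_prop_law \<nu> f0 f1 n (n1 n) (\<delta> n))"
        using True elim by (intro FNR_lower_bound mn \<delta>) (auto simp: k_def)
      also have "\<dots> \<le> \<beta>" using FNR elim by simp
      finally show ?case .
    qed
    moreover have "(\<lambda>n. k * (PF n - PB n)) \<longlonglongrightarrow> k * (1 - 0)"
      using FDP unfolding PF_def[symmetric] by (intro tendsto_intros PB)
    ultimately have "k * (1 - 0) \<le> \<beta>" by (intro tendsto_upperbound) auto
    then show ?thesis by (simp add: k_def)
  qed
  show "\<pi>1 - u + R u \<le> \<beta> * (1 - u)"
  proof (rule field_le_epsilon)
    fix e :: real assume e: "0 < e"
    \<comment> \<open>The bound \<open>e / 2\<close> absorbs the loss \<open>2 * \<epsilon>\<close>,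
      1 is the range of the tail bound, and \<open>R u - \<alpha> * u\<close> keeps the rejection
      fraction below \<open>u\<close>.\<close>
    define \<epsilon> where "\<epsilon> = min (e / 2) (min 1 (R u - \<alpha> * u))"
    have "0 < \<epsilon>" "\<epsilon> \<le> 1" "\<epsilon> \<le> R u - \<alpha> * u" using e Ru by (auto simp: \<epsilon>_def)
    moreover have "\<epsilon> \<le> e / 2" unfolding \<epsilon>_def by (rule min.cobounded1)
    ultimately show "\<pi>1 - u + R u \<le> \<beta> * (1 - u) + e"
      using main[of \<epsilon>] u by (simp add: pos_divide_le_eq)
  qed
qed

end

end

theorem theorem20:
  fixes \<nu> :: "'x measure" and f0 f1 f W :: "'x \<Rightarrow> real" and \<pi>0 \<pi>1 :: real
    and Q :: "'x measure" and p :: "real \<Rightarrow> real" and n1 :: "nat \<Rightarrow> nat" and \<alpha> :: real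
  assumes "\<pi>0 \<in> {0<..<1}" "\<pi>1 \<in> {0<..<1}" "\<pi>0 + \<pi>1 = 1"
    and "prob_density \<nu> f0" "prob_density \<nu> f1"
    and "f = (\<lambda>x. \<pi>0 * f0 x + \<pi>1 * f1 x)"
    and "W = (\<lambda>x. \<pi>0 * f0 x / f x)"
    and "Q = density \<nu> (\<lambda>x. ennreal (f x))"
    and "tie_prob Q W p"
    and "\<forall>n\<ge>1. n1 n \<le> n"
    and "(\<lambda>n. real (n1 n) / real n) \<longlonglongrightarrow> \<pi>1"
    and "\<alpha> \<in> {0..1}"
  shows "(\<forall>\<beta>::real. \<beta> \<ge> b_star Q W p \<alpha> \<longrightarrow> (\<forall>\<epsilon>>0.
            (\<lambda>n. \<P>((\<theta>, X, d) in fixed_prop_law \<nu> f0 f1 n (n1 n) (np_rule Q W p \<alpha> n).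
                    FDP n \<theta> d \<le> \<alpha> + \<epsilon>)) \<longlonglongrightarrow> 1 \<and>
            (\<lambda>n. \<P>((\<theta>, X, d) in fixed_prop_law \<nu> f0 f1 n (n1 n) (np_rule Q W p \<alpha> n).
                    FNP n \<theta> d \<le> \<beta> + \<epsilon>)) \<longlonglongrightarrow> 1)) \<and>
         (\<forall>(\<beta>::real) (\<delta> :: nat \<Rightarrow> (nat \<Rightarrow> 'x) \<Rightarrow> (nat \<Rightarrow> bool) measure).
            (\<forall>n\<ge>1. decision_rule \<nu> n (\<delta> n)) \<longrightarrow>
            (\<lambda>n. \<P>((\<theta>, X, d) in fixed_prop_law \<nu> f0 f1 n (n1 n) (\<delta> n). FDP n \<theta> d \<le> \<alpha>)) \<longlonglongrightarrow> 1 \<longrightarrow>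
            (\<forall>n\<ge>1. FNR n (fixed_prop_law \<nu> f0 f1 n (n1 n) (\<delta> n)) \<le> \<beta>) \<longrightarrow>
            \<beta> \<ge> b_star Q W p \<alpha>)"
proof -
  interpret np_setup \<nu> f0 f1 f W \<pi>0 \<pi>1 Q p
    using assms by unfold_locales
  note ctx = \<open>\<alpha> \<in> {0..1}\<close> \<open>\<forall>n\<ge>1. n1 n \<le> n\<close> \<open>(\<lambda>n. real (n1 n) / real n) \<longlonglongrightarrow> \<pi>1\<close>
  show ?thesis
  proof (intro conjI allI impI)
    fix \<beta> \<epsilon> :: real assume "b_star Q W p \<alpha> \<le> \<beta>" "0 < \<epsilon>"
    moreover from this have "0 \<le> \<beta>" using b_star_nonneg[OF ctx(1)] by simp
    ultimately show "(\<lambda>n. \<P>((\<theta>, X, d) in fixed_prop_law \<nu> f0 f1 n (n1 n) (np_rule Q W p \<alpha> n).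
          FDP n \<theta> d \<le> \<alpha> + \<epsilon>)) \<longlonglongrightarrow> 1"
      and "(\<lambda>n. \<P>((\<theta>, X, d) in fixed_prop_law \<nu> f0 f1 n (n1 n) (np_rule Q W p \<alpha> n).
          FNP n \<theta> d \<le> \<beta> + \<epsilon>)) \<longlonglongrightarrow> 1"
      using np_rule_FDP[OF ctx] np_rule_FNP[OF ctx] by simp_all
  qed (use converse_bound[OF ctx] in blast)
qed

end
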